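(* Let $\mathcal{L}'$ be a first-order language and let $\mathcal{I}$ be an infinite locally finite $\mathcal{L}'$-structure. Then the following are equivalent: (1) $\mathrm{age}(\mathcal{I})$ has the embedding Ramsey property; (2) $\mathcal{I}$ has the continuous modeling property, i.e. $\mathcal{I}$-indexed indiscernibles have the continuous modeling property in every complete continuous theory.
   Context: For $\mathcal{L}'$-structures $A\subseteq B$, $\binom{B}{A}$ denotes the set of embeddings of $A$ into $B$. For $A\subseteq B\subseteq C$ and $r\in\mathbb{N}$, $C\to(B)^A_r$ means: for every coloring $\chi:\binom{C}{A}\to r$ there is $f\in\binom{C}{B}$ such that $\chi$ is constant on $\{f\circ e: e\in\binom{B}{A}\}$. A class $\mathcal{C}$ of finite $\mathcal{L}'$-structures has the embedding Ramsey property (ERP) if for all $A\subseteq B\in\mathcal{C}$ and $r<\omega$ there is $C\in\mathcal{C}$ with $C\to(B)^A_r$. Let $T$ be a complete continuous theory with monster model $\mathfrak{C}$. An $\mathcal{I}$-indexed sequence $(a_i)$ in $\mathfrak{C}$ is $\mathcal{I}$-indiscernible if $\mathrm{qftp}(i_1,\dots,i_n)=\mathrm{qftp}(j_1,\dots,j_n)$ (in $\mathcal{L}'$) implies $\mathrm{tp}(a_{i_1},\dots,a_{i_n})=\mathrm{tp}(a_{j_1},\dots,a_{j_n})$. A sequence $(b_i)_{i\in\mathcal{I}}$ is locally based on $\mathbf{I}=(a_i)_{i\in\mathcal{I}}$ if for every finite set $\Delta$ of formulas, finite tuple $\bar j\subseteq\mathcal{I}$ and $\varepsilon>0$ there is $\bar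 i\subseteq\mathcal{I}$ with $\mathrm{qftp}(\bar i)=\mathrm{qftp}(\bar j)$ and $|\varphi(b_{\bar j})-\varphi(a_{\bar i})|\le\varepsilon$ for all $\varphi\in\Delta$. $\mathcal{I}$-indexed indiscernibles have the continuous modeling property in $T$ if for every $\mathcal{I}$-indexed sequence $\mathbf{I}$ in $\mathfrak{C}$ there is an $\mathcal{I}$-indiscernible sequence in $\mathfrak{C}$ locally based on $\mathbf{I}$. *)

theory Defs
  imports "HOL-Analysis.Analysis" "HOL-Library.FuncSet"
begin

datatype 'f trm = Var nat | Fn 'f "'f trm list"

fun tev :: "('f \<Rightarrow> 'a list \<Rightarrow> 'a) \<Rightarrow> (nat \<Rightarrow> 'a) \<Rightarrow> 'f trm \<Rightarrow> 'a" where
  "tev fi s (Var n) = s n"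
| "tev fi s (Fn f ts) = fi f (map (tev fi s) ts)"

fun fvt :: "'f trm \<Rightarrow> nat set" where
  "fvt (Var n) = {n}"
| "fvt (Fn f ts) = \<Union> (set (map fvt ts))"

fun wft :: "('f \<Rightarrow> nat) \<Rightarrow> 'f trm \<Rightarrow> bool" where
  "wft ar (Var n) = True"
| "wft ar (Fn f ts) = (length ts = ar f \<and> list_all (wft ar) ts)"

section \<open>The index structure: a classical first-order L'-structure with universe UNIV :: 'i set\<close>

record ('i,'f,'r) fstruct =
  cfa  :: "'f \<Rightarrow> nat"              \<comment> \<open>arities of function symbols (constants: arity 0)\<close>
  cra  :: "'r \<Rightarrow> nat"
  cfn  :: "'f \<Rightarrow> 'i list \<Rightarrow> 'i"
  crel :: "'r \<Rightarrow> 'i list \<Rightarrow> bool"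

definition closed_sub :: "('i,'f,'r) fstruct \<Rightarrow> 'i set \<Rightarrow> bool" where
  "closed_sub I X \<longleftrightarrow>
     (\<forall>F xs. length xs = cfa I F \<longrightarrow> set xs \<subseteq> X \<longrightarrow> cfn I F xs \<in> X)"

definition gen_sub :: "('i,'f,'r) fstruct \<Rightarrow> 'i set \<Rightarrow> 'i set" where
  "gen_sub I X = \<Inter> {Y. X \<subseteq> Y \<and> closed_sub I Y}"

definition locally_finite :: "('i,'f,'r) fstruct \<Rightarrow> bool" where
  "locally_finite I \<longleftrightarrow> (\<forall>X. finite X \<longrightarrow> finite (gen_sub I X))"

text \<open>Finite substructures of I (= representatives of age(I), I locally finite).\<close>
definition fin_sub :: "('i,'f,'r) fstruct \<Rightarrow> 'i set \<Rightarrow> bool" where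
  "fin_sub I X \<longleftrightarrow> finite X \<and> closed_sub I X"

definition emb :: "('i,'f,'r) fstruct \<Rightarrow> 'i set \<Rightarrow> 'i set \<Rightarrow> ('i \<Rightarrow> 'i) \<Rightarrow> bool" where
  "emb I A B e \<longleftrightarrow> e \<in> extensional A \<and> e ` A \<subseteq> B \<and> inj_on e A
     \<and> (\<forall>R xs. length xs = cra I R \<longrightarrow> set xs \<subseteq> A \<longrightarrow> (crel I R (map e xs) \<longleftrightarrow> crel I R xs))
     \<and> (\<forall>F xs. length xs = cfa I F \<longrightarrow> set xs \<subseteq> A \<longrightarrow> e (cfn I F xs) = cfn I F (map e xs))"

definition binom :: "('i,'f,'r) fstruct \<Rightarrow> 'i set \<Rightarrow> 'i set \<Rightarrow> ('i \<Rightarrow> 'i) set" where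
  "binom I B A = {e. emb I A B e}"

definition arrows :: "('i,'f,'r) fstruct \<Rightarrow> 'i set \<Rightarrow> 'i set \<Rightarrow> 'i set \<Rightarrow> nat \<Rightarrow> bool" where
  "arrows I C B A r \<longleftrightarrow>
     (\<forall>col. col \<in> binom I C A \<rightarrow> {..<r} \<longrightarrow>
        (\<exists>f \<in> binom I C B. \<exists>c. \<forall>e \<in> binom I B A. col (compose A f e) = c))"

definition age_ERP :: "('i,'f,'r) fstruct \<Rightarrow> bool" where
  "age_ERP I \<longleftrightarrow>
     (\<forall>A B r. fin_sub I A \<and> fin_sub I B \<and> A \<subseteq> B \<longrightarrow> (\<exists>C. fin_sub I C \<and> arrows I C B A r))"

datatype ('f,'r) atom = AEq "'f trm" "'f trm" | ARel 'r "'f trm list"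

fun aholds :: "('i,'f,'r) fstruct \<Rightarrow> (nat \<Rightarrow> 'i) \<Rightarrow> ('f,'r) atom \<Rightarrow> bool" where
  "aholds I s (AEq t u) = (tev (cfn I) s t = tev (cfn I) s u)"
| "aholds I s (ARel R ts) = crel I R (map (tev (cfn I) s) ts)"

fun wf_atom :: "('i,'f,'r) fstruct \<Rightarrow> ('f,'r) atom \<Rightarrow> bool" where
  "wf_atom I (AEq t u) = (wft (cfa I) t \<and> wft (cfa I) u)"
| "wf_atom I (ARel R ts) = (length ts = cra I R \<and> list_all (wft (cfa I)) ts)"

fun avars :: "('f,'r) atom \<Rightarrow> nat set" where
  "avars (AEq t u) = fvt t \<union> fvt u"
| "avars (ARel R ts) = \<Union> (set (map fvt ts))"

text \<open>qftp(is) = qftp(js); the tuple xs is assigned to the variables 0..length xs - 1.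
  (Quantifier-free formulas are Boolean combinations of atomic ones.)\<close>
definition qftp_eq :: "('i,'f,'r) fstruct \<Rightarrow> 'i list \<Rightarrow> 'i list \<Rightarrow> bool" where
  "qftp_eq I xs ys \<longleftrightarrow> length xs = length ys \<and>
     (\<forall>\<alpha>. wf_atom I \<alpha> \<and> avars \<alpha> \<subseteq> {..<length xs} \<longrightarrow>
        (aholds I (\<lambda>k. xs ! k) \<alpha> \<longleftrightarrow> aholds I (\<lambda>k. ys ! k) \<alpha>))"

section \<open>Continuous first-order logic (one-sorted, Ben Yaacov--Berenstein--Henson--Usvyatsov)\<close>

record ('g,'s) csig =
  fa   :: "'g \<Rightarrow> nat"
  ra   :: "'s \<Rightarrow> nat"
  fmod :: "'g \<Rightarrow> real \<Rightarrow> real"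
  rmod :: "'s \<Rightarrow> real \<Rightarrow> real"

record ('m,'g,'s) mstruct =
  md  :: "'m \<Rightarrow> 'm \<Rightarrow> real"
  mfn :: "'g \<Rightarrow> 'm list \<Rightarrow> 'm"
  mrel :: "'s \<Rightarrow> 'm list \<Rightarrow> real"

definition mstruct_ok :: "('g,'s) csig \<Rightarrow> ('m,'g,'s) mstruct \<Rightarrow> bool" where
  "mstruct_ok \<sigma> M \<longleftrightarrow>
     (\<forall>x y. 0 \<le> md M x y \<and> md M x y \<le> 1 \<and> (md M x y = 0 \<longleftrightarrow> x = y) \<and> md M x y = md M y x)
   \<and> (\<forall>x y z. md M x z \<le> md M x y + md M y z)
   \<and> (\<forall>X :: nat \<Rightarrow> 'm. (\<forall>e>0. \<exists>N. \<forall>m\<ge>N. \<forall>n\<ge>N. md M (X m) (X n) < e) \<longrightarrow>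
        (\<exists>l. (\<lambda>n. md M (X n) l) \<longlonglongrightarrow> 0))
   \<and> (\<forall>F. \<forall>e>0. fmod \<sigma> F e > 0 \<and>
        (\<forall>xs ys. length xs = fa \<sigma> F \<longrightarrow> length ys = fa \<sigma> F \<longrightarrow>
           (\<forall>k < fa \<sigma> F. md M (xs ! k) (ys ! k) < fmod \<sigma> F e) \<longrightarrow>
           md M (mfn M F xs) (mfn M F ys) \<le> e))
   \<and> (\<forall>R xs. length xs = ra \<sigma> R \<longrightarrow> 0 \<le> mrel M R xs \<and> mrel M R xs \<le> 1)
   \<and> (\<forall>R. \<forall>e>0. rmod \<sigma> R e > 0 \<and>
        (\<forall>xs ys. length xs = ra \<sigma> R \<longrightarrow> length ys = ra \<sigma> R \<longrightarrow>
           (\<forall>k < ra \<sigma> R. md M (xs ! k) (ys ! k) < rmod \<sigma> R e) \<longrightarrow>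
           \<bar>mrel M R xs - mrel M R ys\<bar> \<le> e))"

text \<open>Continuous formulas, built with the full system of connectives
  1, \<not>, x/2, \<dot>- and the quantifiers sup, inf.\<close>
datatype ('g,'s) cfml =
    COne
  | CRel 's "'g trm list"
  | CDist "'g trm" "'g trm"
  | CNeg "('g,'s) cfml"
  | CHalf "('g,'s) cfml"
  | CMinus "('g,'s) cfml" "('g,'s) cfml"
  | CSup nat "('g,'s) cfml"
  | CInf nat "('g,'s) cfml"

fun feval :: "('m,'g,'s) mstruct \<Rightarrow> (nat \<Rightarrow> 'm) \<Rightarrow> ('g,'s) cfml \<Rightarrow> real" where
  "feval M s COne = 1"
| "feval M s (CRel R ts) = mrel M R (map (tev (mfn M) s) ts)"
| "feval M s (CDist t u) = md M (tev (mfn M) s t) (tev (mfn M) s u)"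
| "feval M s (CNeg \<phi>) = 1 - feval M s \<phi>"
| "feval M s (CHalf \<phi>) = feval M s \<phi> / 2"
| "feval M s (CMinus \<phi> \<psi>) = max 0 (feval M s \<phi> - feval M s \<psi>)"
| "feval M s (CSup x \<phi>) = (SUP m. feval M (s(x := m)) \<phi>)"
| "feval M s (CInf x \<phi>) = (INF m. feval M (s(x := m)) \<phi>)"

fun cfv :: "('g,'s) cfml \<Rightarrow> nat set" where
  "cfv COne = {}"
| "cfv (CRel R ts) = \<Union> (set (map fvt ts))"
| "cfv (CDist t u) = fvt t \<union> fvt u"
| "cfv (CNeg \<phi>) = cfv \<phi>"
| "cfv (CHalf \<phi>) = cfv \<phi>"
| "cfv (CMinus \<phi> \<psi>) = cfv \<phi> \<union> cfv \<psi>"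
| "cfv (CSup x \<phi>) = cfv \<phi> - {x}"
| "cfv (CInf x \<phi>) = cfv \<phi> - {x}"

fun cwf :: "('g,'s) csig \<Rightarrow> ('g,'s) cfml \<Rightarrow> bool" where
  "cwf \<sigma> COne = True"
| "cwf \<sigma> (CRel R ts) = (length ts = ra \<sigma> R \<and> list_all (wft (fa \<sigma>)) ts)"
| "cwf \<sigma> (CDist t u) = (wft (fa \<sigma>) t \<and> wft (fa \<sigma>) u)"
| "cwf \<sigma> (CNeg \<phi>) = cwf \<sigma> \<phi>"
| "cwf \<sigma> (CHalf \<phi>) = cwf \<sigma> \<phi>"
| "cwf \<sigma> (CMinus \<phi> \<psi>) = (cwf \<sigma> \<phi> \<and> cwf \<sigma> \<psi>)"
| "cwf \<sigma> (CSup x \<phi>) = cwf \<sigma> \<phi>"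
| "cwf \<sigma> (CInf x \<phi>) = cwf \<sigma> \<phi>"

text \<open>Saturation: every partial type in the variable 0 (a set of conditions \<phi>(x,s) = 0)
  over a parameter set A with |A| \<le> |K| which is approximately finitely satisfiable
  is realized.  With K = UNIV :: 'i set this is |I|^+-saturation.\<close>
definition csaturated :: "('g,'s) csig \<Rightarrow> ('m,'g,'s) mstruct \<Rightarrow> 'k set \<Rightarrow> bool" where
  "csaturated \<sigma> M K \<longleftrightarrow>
     (\<forall>(A :: 'm set) (p :: (('g,'s) cfml \<times> (nat \<Rightarrow> 'm)) set).
        (\<exists>g :: 'm \<Rightarrow> 'k. inj_on g A \<and> g ` A \<subseteq> K)
      \<longrightarrow> (\<forall>(\<phi>, s) \<in> p. cwf \<sigma> \<phi> \<and> (\<forall>v \<in> cfv \<phi> - {0}. s v \<in> A))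
      \<longrightarrow> (\<forall>p0 \<subseteq> p. finite p0 \<longrightarrow> (\<forall>e>0. \<exists>m. \<forall>(\<phi>, s) \<in> p0. feval M (s(0 := m)) \<phi> \<le> e))
      \<longrightarrow> (\<exists>m. \<forall>(\<phi>, s) \<in> p. feval M (s(0 := m)) \<phi> = 0))"

definition indiscernible ::
  "('i,'f,'r) fstruct \<Rightarrow> ('g,'s) csig \<Rightarrow> ('m,'g,'s) mstruct \<Rightarrow> ('i \<Rightarrow> 'm) \<Rightarrow> bool" where
  "indiscernible I \<sigma> M b \<longleftrightarrow>
     (\<forall>ks js. qftp_eq I ks js \<longrightarrow>
        (\<forall>\<phi>. cwf \<sigma> \<phi> \<and> cfv \<phi> \<subseteq> {..<length ks} \<longrightarrow>
           feval M (\<lambda>k. map b ks ! k) \<phi> = feval M (\<lambda>k. map b js ! k) \<phi>))"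

definition locally_based ::
  "('i,'f,'r) fstruct \<Rightarrow> ('g,'s) csig \<Rightarrow> ('m,'g,'s) mstruct \<Rightarrow> ('i \<Rightarrow> 'm) \<Rightarrow> ('i \<Rightarrow> 'm) \<Rightarrow> bool" where
  "locally_based I \<sigma> M b a \<longleftrightarrow>
     (\<forall>\<Delta> js e. finite \<Delta> \<and> (\<forall>\<phi>\<in>\<Delta>. cwf \<sigma> \<phi> \<and> cfv \<phi> \<subseteq> {..<length js}) \<and> e > 0 \<longrightarrow>
        (\<exists>ks. qftp_eq I ks js \<and>
           (\<forall>\<phi>\<in>\<Delta>. \<bar>feval M (\<lambda>k. map b js ! k) \<phi> - feval M (\<lambda>k. map a ks ! k) \<phi>\<bar> \<le> e)))"

text \<open>I-indexed indiscernibles have the continuous modeling property in Th(M), M playing the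
  role of the monster model.\<close>
definition cmp_in ::
  "('i,'f,'r) fstruct \<Rightarrow> ('g,'s) csig \<Rightarrow> ('m,'g,'s) mstruct \<Rightarrow> bool" where
  "cmp_in I \<sigma> M \<longleftrightarrow> (\<forall>a. \<exists>b. indiscernible I \<sigma> M b \<and> locally_based I \<sigma> M b a)"

text \<open>CMP for all complete continuous theories whose symbols live in 'g,'s and whose
  (sufficiently saturated) models live in 'm.\<close>
definition CMP ::
  "('i,'f,'r) fstruct \<Rightarrow> 'g itself \<Rightarrow> 's itself \<Rightarrow> 'm itself \<Rightarrow> bool" where
  "CMP I _ _ _ \<longleftrightarrow>
     (\<forall>(\<sigma> :: ('g,'s) csig) (M :: ('m,'g,'s) mstruct).
        mstruct_ok \<sigma> M \<and> csaturated \<sigma> M (UNIV :: 'i set) \<longrightarrow> cmp_in I \<sigma> M)"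

type_synonym ('i,'f,'r) bigsym = "'i + 'f + 'r + nat"

end

theory Submission
  imports Defs
begin

text \<open>From the Ramsey property to indiscernibles: given a sequence \<open>a\<close>, consider the type in
  \<open>'i\<close>-many variables that says that the sequence is indiscernible and satisfies every condition
  that holds along a whole quantifier-free class in \<open>a\<close>. By the Ramsey property, applied once for
  each of finitely many formulas with colours the values rounded to multiples of \<open>e\<close>, finite parts
  of this type are approximately satisfied by a copy of a finite substructure inside \<open>a\<close>;
  saturation realizes the whole type.

  Conversely, if the Ramsey property fails for \<open>A \<subseteq> B\<close>, compactness glues the bad colourings of
  finite substructures to one bad colouring of all embeddings of \<open>A\<close> into \<open>I\<close>. It is recorded by an
  \<open>|A|\<close>-ary relation on a sequence in a saturated discrete structure whose relation is generic; an
  indiscernible sequence locally based on it would produce a monochromatic copy of \<open>B\<close>. Genericity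
  (every prescription of values over a small set is realized by a new element) yields quantifier
  elimination by back-and-forth, and with compactness it yields saturation.\<close>

subsection \<open>Quantifier-free types and embeddings\<close>

text \<open>Formulas have variables in \<open>nat\<close>, sequences have indices in an arbitrary
  type \<open>'i\<close>, and saturation speaks about one variable only: \<open>definable\<close>
  functions of a whole sequence bridge the first gap, a Zorn argument the second. In the forward
  direction a copy found inside \<open>a\<close> is indiscernible only up to \<open>e\<close>,
  because only finitely many colours are available; saturation turns this into equality. In the
  converse the modeling property is tested on one sequence in one saturated structure, so the bad
  colourings must first be combined into one, and that colouring must be part of a structure whose
  types are completely understood. The universe \<open>'y set\<close> is larger than any family
  indexed by \<open>'y\<close>; hence a diagonal argument finds elements outside a given family, and
  an element can carry a code of its own behaviour over such a family. The metric is discrete and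
  relation values are multiples of 1/\<open>r\<close>, so an approximation within half of
  1/\<open>r\<close> is an equality of colours.\<close>

lemma tev_cong: "(\<And>v. v \<in> fvt t \<Longrightarrow> s v = s' v) \<Longrightarrow> tev fi s t = tev fi s' t"
proof (induction t)
  case (Fn f ts)
  have "map (tev fi s) ts = map (tev fi s') ts"
    using Fn by (intro map_cong) auto
  then show ?case by (simp only: tev.simps)
qed simp

lemma gen_sub_superset: "X \<subseteq> gen_sub I X"
  unfolding gen_sub_def by auto

lemma gen_sub_closed: "closed_sub I (gen_sub I X)"
  unfolding gen_sub_def closed_sub_def by (auto simp: subset_iff)

lemma gen_sub_least: "X \<subseteq> Y \<Longrightarrow> closed_sub I Y \<Longrightarrow> gen_sub I X \<subseteq> Y"
  unfolding gen_sub_def by auto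

lemma closed_subD: "closed_sub I X \<Longrightarrow> length xs = cfa I F \<Longrightarrow> set xs \<subseteq> X \<Longrightarrow> cfn I F xs \<in> X"
  unfolding closed_sub_def by blast

lemma fin_sub_gen_sub:
  assumes "locally_finite I" "finite X"
  shows "fin_sub I (gen_sub I X)"
  using assms gen_sub_closed unfolding fin_sub_def locally_finite_def by blast

lemma tev_in_closed:
  assumes "closed_sub I Y"
  shows "wft (cfa I) t \<Longrightarrow> (\<And>v. v \<in> fvt t \<Longrightarrow> s v \<in> Y) \<Longrightarrow> tev (cfn I) s t \<in> Y"
proof (induction t)
  case (Fn f ts)
  have "set (map (tev (cfn I) s) ts) \<subseteq> Y"
    using Fn by (auto simp: list_all_iff)
  then show ?case
    using Fn.prems(1) by (auto intro!: closed_subD[OF assms])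
qed simp

text \<open>The values of terms at \<open>xs\<close> include the entries of \<open>xs\<close> and
  are closed under the functions, so they exhaust the generated substructure. A type, which only
  sees terms, therefore controls all of it.\<close>

lemma gen_sub_terms:
  assumes "x \<in> gen_sub I (set xs)"
  shows "\<exists>t. wft (cfa I) t \<and> fvt t \<subseteq> {..<length xs} \<and> tev (cfn I) ((!) xs) t = x"
proof -
  define Y where "Y = {x. \<exists>t. wft (cfa I) t \<and> fvt t \<subseteq> {..<length xs} \<and> tev (cfn I) ((!) xs) t = x}"
  have "set xs \<subseteq> Y"
  proof
    fix y assume "y \<in> set xs"
    then obtain k where "k < length xs" "xs ! k = y" by (auto simp: in_set_conv_nth)
    then show "y \<in> Y" unfolding Y_def by (auto intro!: exI[of _ "Var k"])
  qed
  moreover have "closed_sub I Y"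
    unfolding closed_sub_def
  proof (intro allI impI)
    fix F ys assume l: "length ys = cfa I F" and "set ys \<subseteq> Y"
    then have *: "\<forall>y \<in> set ys. \<exists>t. wft (cfa I) t \<and> fvt t \<subseteq> {..<length xs} \<and> tev (cfn I) ((!) xs) t = y"
      unfolding Y_def by auto
    obtain f where f: "\<forall>y \<in> set ys. wft (cfa I) (f y) \<and> fvt (f y) \<subseteq> {..<length xs} \<and> tev (cfn I) ((!) xs) (f y) = y"
      using bchoice[OF *] by blast
    have "map (tev (cfn I) ((!) xs) \<circ> f) ys = ys"
      using f by (auto intro: map_idI)
    moreover have "wft (cfa I) (Fn F (map f ys))" "fvt (Fn F (map f ys)) \<subseteq> {..<length xs}"
      using f l by (auto simp: list_all_iff subset_iff)
    ultimately show "cfn I F ys \<in> Y"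
      unfolding Y_def by (intro CollectI exI[of _ "Fn F (map f ys)"]) auto
  qed
  ultimately have "gen_sub I (set xs) \<subseteq> Y" by (rule gen_sub_least)
  then show ?thesis using assms unfolding Y_def by auto
qed

section \<open>Embeddings and their effect on quantifier-free types\<close>

lemma embD:
  assumes "emb I A B e"
  shows "e \<in> extensional A" "\<And>x. x \<in> A \<Longrightarrow> e x \<in> B" "inj_on e A"
    "\<And>R xs. length xs = cra I R \<Longrightarrow> set xs \<subseteq> A \<Longrightarrow> crel I R (map e xs) \<longleftrightarrow> crel I R xs"
    "\<And>F xs. length xs = cfa I F \<Longrightarrow> set xs \<subseteq> A \<Longrightarrow> e (cfn I F xs) = cfn I F (map e xs)"
  using assms unfolding emb_def by auto

lemma emb_image_mono: "emb I A B e \<Longrightarrow> e ` A \<subseteq> C \<Longrightarrow> emb I A C e"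
  unfolding emb_def by auto

lemma emb_restrict:
  assumes e: "emb I B C e" and sub: "A \<subseteq> B" and cl: "closed_sub I A"
  shows "emb I A C (restrict e A)"
proof -
  have m: "map (restrict e A) xs = map e xs" if "set xs \<subseteq> A" for xs
    using that by (intro map_cong) auto
  show ?thesis
    unfolding emb_def
  proof (intro conjI allI impI)
    show "restrict e A ` A \<subseteq> C" "inj_on (restrict e A) A" "restrict e A \<in> extensional A"
      using embD(2,3)[OF e] sub by (auto simp: inj_on_def subset_iff)
  next
    fix R xs assume "length xs = cra I R" "set xs \<subseteq> A"
    then show "crel I R (map (restrict e A) xs) \<longleftrightarrow> crel I R xs"
      using embD(4)[OF e, of xs R] sub by (simp add: m)
  next
    fix F xs assume "length xs = cfa I F" "set xs \<subseteq> A"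
    then show "restrict e A (cfn I F xs) = cfn I F (map (restrict e A) xs)"
      using embD(5)[OF e, of xs F] sub closed_subD[OF cl, of xs F] by (simp add: m)
  qed
qed

lemma emb_inclusion:
  assumes "closed_sub I A" "A \<subseteq> B"
  shows "emb I A B (\<lambda>x\<in>A. x)"
proof -
  have "emb I UNIV UNIV (\<lambda>x. x)" unfolding emb_def by simp
  then have "emb I A UNIV (\<lambda>x\<in>A. x)"
    by (rule emb_restrict) (use assms(1) in auto)
  then show ?thesis by (rule emb_image_mono) (use assms(2) in auto)
qed

lemma emb_compose:
  assumes cl: "closed_sub I A" and e: "emb I A B e" and f: "emb I B C f"
  shows "emb I A C (compose A f e)"
proof -
  have m: "map (compose A f e) xs = map f (map e xs)" if "set xs \<subseteq> A" for xs
    using that by (auto simp: compose_def)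
  have s: "set (map e xs) \<subseteq> B" if "set xs \<subseteq> A" for xs
    using that embD(2)[OF e] by auto
  show ?thesis
    unfolding emb_def
  proof (intro conjI allI impI)
    show "compose A f e \<in> extensional A" "compose A f e ` A \<subseteq> C"
      using embD(2)[OF e] embD(2)[OF f] by (auto simp: compose_def)
    show "inj_on (compose A f e) A"
      using embD(2,3)[OF e] embD(3)[OF f] by (auto simp: compose_def inj_on_def subset_iff)
  next
    fix R xs assume "length xs = cra I R" "set xs \<subseteq> A"
    then show "crel I R (map (compose A f e) xs) \<longleftrightarrow> crel I R xs"
      using embD(4)[OF e, of xs R] embD(4)[OF f, of "map e xs" R] s[of xs]
      unfolding m[OF \<open>set xs \<subseteq> A\<close>] by simp
  next
    fix F xs assume "length xs = cfa I F" "set xs \<subseteq> A"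
    then show "compose A f e (cfn I F xs) = cfn I F (map (compose A f e) xs)"
      using embD(5)[OF e, of xs F] embD(5)[OF f, of "map e xs" F] s[of xs] closed_subD[OF cl, of xs F]
      unfolding m[OF \<open>set xs \<subseteq> A\<close>] by (simp add: compose_def)
  qed
qed

lemma emb_image_closed:
  assumes e: "emb I A B e" and cl: "closed_sub I A"
  shows "closed_sub I (e ` A)"
  unfolding closed_sub_def
proof (intro allI impI)
  fix F ys assume l: "length ys = cfa I F" and "set ys \<subseteq> e ` A"
  then have xs: "ys = map e (map (inv_into A e) ys)" "set (map (inv_into A e) ys) \<subseteq> A"
    by (auto simp: f_inv_into_f inv_into_into subset_iff intro!: map_idI[symmetric])
  have "cfn I F ys = e (cfn I F (map (inv_into A e) ys))"
    using embD(5)[OF e _ xs(2), of F] l xs(1) by simp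
  then show "cfn I F ys \<in> e ` A"
    using closed_subD[OF cl _ xs(2), of F] l by simp
qed

lemma emb_tev:
  assumes e: "emb I A B e" and cl: "closed_sub I A"
  shows "wft (cfa I) t \<Longrightarrow> (\<And>v. v \<in> fvt t \<Longrightarrow> s v \<in> A) \<Longrightarrow>
    e (tev (cfn I) s t) = tev (cfn I) (\<lambda>v. e (s v)) t"
proof (induction t)
  case (Fn f ts)
  have "set (map (tev (cfn I) s) ts) \<subseteq> A"
    using Fn.prems by (auto simp: list_all_iff intro!: tev_in_closed[OF cl])
  moreover have "map (e \<circ> tev (cfn I) s) ts = map (tev (cfn I) (\<lambda>v. e (s v))) ts"
    using Fn by (intro map_cong) (auto simp: list_all_iff)
  ultimately show ?case
    using embD(5)[OF e, of "map (tev (cfn I) s) ts" f] Fn.prems(1) by (simp del: map_eq_conv)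
qed simp

lemma qftp_eq_emb:
  assumes e: "emb I A B e" and cl: "closed_sub I A" and xs: "set xs \<subseteq> A"
  shows "qftp_eq I (map e xs) xs"
proof -
  have tm: "tev (cfn I) ((!) (map e xs)) t = e (tev (cfn I) ((!) xs) t) \<and> tev (cfn I) ((!) xs) t \<in> A"
    if "wft (cfa I) t" "fvt t \<subseteq> {..<length xs}" for t
  proof -
    have s: "xs ! v \<in> A" if "v \<in> fvt t" for v
      using that xs \<open>fvt t \<subseteq> _\<close> by (auto simp: subset_iff)
    have "tev (cfn I) ((!) (map e xs)) t = tev (cfn I) (\<lambda>v. e (xs ! v)) t"
      using that by (intro tev_cong) auto
    then show ?thesis
      using emb_tev[OF e cl that(1), of "(!) xs"] tev_in_closed[OF cl that(1), of "(!) xs"] s by simp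
  qed
  have "aholds I ((!) (map e xs)) \<alpha> \<longleftrightarrow> aholds I ((!) xs) \<alpha>"
    if "wf_atom I \<alpha>" "avars \<alpha> \<subseteq> {..<length xs}" for \<alpha>
  proof (cases \<alpha>)
    case (AEq t u)
    then show ?thesis
      using that tm[of t] tm[of u] embD(3)[OF e] by (auto simp: inj_on_def)
  next
    case (ARel R ts)
    have "fvt t \<subseteq> {..<length xs} \<and> wft (cfa I) t" if "t \<in> set ts" for t
      using that \<open>avars \<alpha> \<subseteq> _\<close> \<open>wf_atom I \<alpha>\<close> ARel by (auto simp: list_all_iff)
    then have "map (tev (cfn I) ((!) (map e xs))) ts = map e (map (tev (cfn I) ((!) xs)) ts)"
      "set (map (tev (cfn I) ((!) xs)) ts) \<subseteq> A"
      using tm by auto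
    then show ?thesis
      using embD(4)[OF e, of "map (tev (cfn I) ((!) xs)) ts" R] ARel that(1)
      by (simp only: aholds.simps) simp
  qed
  then show ?thesis unfolding qftp_eq_def by simp
qed

lemma qftp_eq_sym: "qftp_eq I xs ys \<Longrightarrow> qftp_eq I ys xs"
  unfolding qftp_eq_def by auto

text \<open>The map sends the value of a term at \<open>xs\<close> to its value at
  \<open>ys\<close>. Agreement on equations makes it well defined and injective, agreement on
  relational atoms makes it preserve and reflect relations.\<close>

lemma emb_of_qftp_eq:
  assumes q: "qftp_eq I xs ys"
  shows "\<exists>e. emb I (gen_sub I (set xs)) (gen_sub I (set ys)) e \<and> map e xs = ys"
proof -
  let ?A = "gen_sub I (set xs)" and ?B = "gen_sub I (set ys)"
  let ?w = "\<lambda>t. wft (cfa I) t \<and> fvt t \<subseteq> {..<length xs}"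
  let ?x = "tev (cfn I) ((!) xs)" and ?y = "tev (cfn I) ((!) ys)"
  have len: "length xs = length ys" using q unfolding qftp_eq_def by simp
  have eq: "?x t = ?x u \<longleftrightarrow> ?y t = ?y u" if "?w t" "?w u" for t u
  proof -
    have "wf_atom I (AEq t u)" "avars (AEq t u) \<subseteq> {..<length xs}"
      using that by auto
    then have "aholds I ((!) xs) (AEq t u) = aholds I ((!) ys) (AEq t u)"
      using q unfolding qftp_eq_def by blast
    then show ?thesis by simp
  qed
  have *: "\<forall>x \<in> ?A. \<exists>t. ?w t \<and> ?x t = x" using gen_sub_terms[of _ I xs] by blast
  obtain T where T: "\<forall>x \<in> ?A. ?w (T x) \<and> ?x (T x) = x"
    using bchoice[OF *] by blast
  define e where "e = (\<lambda>x\<in>?A. ?y (T x))"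
  have xA: "?x t \<in> ?A" if "?w t" for t
  proof (intro tev_in_closed gen_sub_closed)
    show "wft (cfa I) t" using that by simp
    fix v assume "v \<in> fvt t"
    then show "xs ! v \<in> ?A" using that gen_sub_superset[of "set xs" I] by (auto simp: subset_iff)
  qed
  have yB: "?y t \<in> ?B" if "?w t" for t
  proof (intro tev_in_closed gen_sub_closed)
    show "wft (cfa I) t" using that by simp
    fix v assume "v \<in> fvt t"
    then show "ys ! v \<in> ?B" using that gen_sub_superset[of "set ys" I] len by (auto simp: subset_iff)
  qed
  \<comment> \<open>\<open>T\<close> picks only one name of each element; by \<open>eq\<close> every
    other name gives the same image.\<close>
  have e: "e (?x t) = ?y t" if "?w t" for t
    using eq[of "T (?x t)" t] T xA[OF that] that unfolding e_def by auto
  have tl: "\<exists>ts. list_all ?w ts \<and> zs = map ?x ts" if "set zs \<subseteq> ?A" for zs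
    using that T by (intro exI[of _ "map T zs"]) (auto simp: list_all_iff subset_iff intro!: map_idI[symmetric])
  have me: "map e (map ?x ts) = map ?y ts" if "list_all ?w ts" for ts
    using that e by (auto simp: list_all_iff)
  have "emb I ?A ?B e"
    unfolding emb_def
  proof (intro conjI allI impI)
    show "e \<in> extensional ?A" unfolding e_def by simp
    show "e ` ?A \<subseteq> ?B" using T yB unfolding e_def by auto
    show "inj_on e ?A"
    proof (rule inj_onI)
      fix x y assume "x \<in> ?A" "y \<in> ?A" "e x = e y"
      then show "x = y" using T eq[of "T x" "T y"] unfolding e_def by simp
    qed
  next
    fix R zs assume l: "length zs = cra I R" and "set zs \<subseteq> ?A"
    then obtain ts where ts: "list_all ?w ts" "zs = map ?x ts" using tl by blast
    then have "wf_atom I (ARel R ts)" "avars (ARel R ts) \<subseteq> {..<length xs}"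
      using l by (auto simp: list_all_iff)
    then have "aholds I ((!) xs) (ARel R ts) = aholds I ((!) ys) (ARel R ts)"
      using q unfolding qftp_eq_def by blast
    then show "crel I R (map e zs) = crel I R zs"
      unfolding ts(2) me[OF ts(1)] by simp
  next
    fix F zs assume l: "length zs = cfa I F" and "set zs \<subseteq> ?A"
    then obtain ts where ts: "list_all ?w ts" "zs = map ?x ts" using tl by blast
    then have "?w (Fn F ts)" using l by (auto simp: list_all_iff)
    then have "e (?x (Fn F ts)) = ?y (Fn F ts)" by (rule e)
    then show "e (cfn I F zs) = cfn I F (map e zs)"
      unfolding ts(2) me[OF ts(1)] by simp
  qed
  moreover have "map e xs = ys"
  proof (rule nth_equalityI)
    fix k assume "k < length (map e xs)"
    then show "map e xs ! k = ys ! k" using e[of "Var k"] by simp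
  qed (use len in simp)
  ultimately show ?thesis by blast
qed

subsection \<open>Continuous formulas\<close>

lemma finite_fvt: "finite (fvt t)"
  by (induction t) auto

lemma finite_cfv: "finite (cfv \<phi>)"
  by (induction \<phi>) (auto simp: finite_fvt)

lemma feval_cong: "(\<And>v. v \<in> cfv \<phi> \<Longrightarrow> s v = s' v) \<Longrightarrow> feval M s \<phi> = feval M s' \<phi>"
proof (induction \<phi> arbitrary: s s')
  case (CRel R ts)
  have "map (tev (mfn M) s) ts = map (tev (mfn M) s') ts"
    using CRel by (intro map_cong tev_cong) auto
  then show ?case by (simp only: feval.simps)
next
  case (CDist t u)
  then show ?case using tev_cong[of t s s'] tev_cong[of u s s'] by simp
next
  case (CNeg \<phi>)
  have "feval M s \<phi> = feval M s' \<phi>" using CNeg.prems by (intro CNeg.IH) simp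
  then show ?case by simp
next
  case (CHalf \<phi>)
  have "feval M s \<phi> = feval M s' \<phi>" using CHalf.prems by (intro CHalf.IH) simp
  then show ?case by simp
next
  case (CMinus \<phi> \<psi>)
  have "feval M s \<phi> = feval M s' \<phi>" "feval M s \<psi> = feval M s' \<psi>"
    using CMinus.prems by (intro CMinus.IH; simp)+
  then show ?case by simp
next
  case (CSup x \<phi>)
  have "feval M (s(x := m)) \<phi> = feval M (s'(x := m)) \<phi>" for m
    using CSup.prems by (intro CSup.IH) auto
  then show ?case by simp
next
  case (CInf x \<phi>)
  have "feval M (s(x := m)) \<phi> = feval M (s'(x := m)) \<phi>" for m
    using CInf.prems by (intro CInf.IH) auto
  then show ?case by simp
qed simp

lemma feval_bounds:
  assumes ok: "mstruct_ok \<sigma> M"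
  shows "cwf \<sigma> \<phi> \<Longrightarrow> feval M s \<phi> \<in> {0..1}"
proof (induction \<phi> arbitrary: s)
  case (CRel R ts)
  then show ?case using ok unfolding mstruct_ok_def by simp
next
  case (CDist t u)
  then show ?case using ok unfolding mstruct_ok_def by simp
next
  case (CMinus \<phi> \<psi>)
  have "feval M s \<phi> \<in> {0..1}" "feval M s \<psi> \<in> {0..1}"
    using CMinus by auto
  then show ?case by auto
next
  case (CSup x \<phi>)
  have b: "feval M (s(x := m)) \<phi> \<in> {0..1}" for m
    using CSup by simp
  have "bdd_above (range (\<lambda>m. feval M (s(x := m)) \<phi>))"
    using b by (auto intro!: bdd_aboveI[of _ 1])
  then have "feval M (s(x := undefined)) \<phi> \<le> (SUP m. feval M (s(x := m)) \<phi>)"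
    by (intro cSUP_upper) auto
  moreover have "(SUP m. feval M (s(x := m)) \<phi>) \<le> 1"
    using b by (intro cSUP_least) auto
  ultimately show ?case using b[of undefined] by auto
next
  case (CInf x \<phi>)
  have b: "feval M (s(x := m)) \<phi> \<in> {0..1}" for m
    using CInf by simp
  have "bdd_below (range (\<lambda>m. feval M (s(x := m)) \<phi>))"
    using b by (auto intro!: bdd_belowI[of _ 0])
  then have "feval M (s(x := undefined)) \<phi> \<ge> (INF m. feval M (s(x := m)) \<phi>)"
    by (intro cINF_lower) auto
  moreover have "(INF m. feval M (s(x := m)) \<phi>) \<ge> 0"
    using b by (intro cINF_greatest) auto
  ultimately show ?case using b[of undefined] by auto
next
  case (CHalf \<phi>)
  then have "feval M s \<phi> \<in> {0..1}" by simp
  then show ?case by simp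
qed auto

section \<open>Renaming of free variables\<close>

fun rename_trm :: "(nat \<Rightarrow> nat) \<Rightarrow> 'g trm \<Rightarrow> 'g trm" where
  "rename_trm \<rho> (Var n) = Var (\<rho> n)"
| "rename_trm \<rho> (Fn f ts) = Fn f (map (rename_trm \<rho>) ts)"

lemma tev_rename_trm: "tev fi s (rename_trm \<rho> t) = tev fi (s \<circ> \<rho>) t"
proof (induction t)
  case (Fn f ts)
  then show ?case by (simp add: o_def cong: map_cong)
qed simp

lemma fvt_rename_trm: "fvt (rename_trm \<rho> t) = \<rho> ` fvt t"
  by (induction t) auto

lemma wft_rename_trm: "wft ar (rename_trm \<rho> t) = wft ar t"
  by (induction t) (auto simp: list_all_iff)

definition fresh_for :: "nat set \<Rightarrow> nat" where
  "fresh_for X = Suc (Max (insert 0 X))"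

lemma fresh_for: "finite X \<Longrightarrow> fresh_for X \<notin> X"
proof
  assume "finite X" "fresh_for X \<in> X"
  then have "fresh_for X \<le> Max (insert 0 X)" by (intro Max_ge) auto
  then show False unfolding fresh_for_def by simp
qed

text \<open>The bound variable is replaced by a fresh one, so that \<open>\<rho>\<close> need not be injective.\<close>
fun rename :: "(nat \<Rightarrow> nat) \<Rightarrow> ('g,'s) cfml \<Rightarrow> ('g,'s) cfml" where
  "rename \<rho> COne = COne"
| "rename \<rho> (CRel R ts) = CRel R (map (rename_trm \<rho>) ts)"
| "rename \<rho> (CDist t u) = CDist (rename_trm \<rho> t) (rename_trm \<rho> u)"
| "rename \<rho> (CNeg \<phi>) = CNeg (rename \<rho> \<phi>)"
| "rename \<rho> (CHalf \<phi>) = CHalf (rename \<rho> \<phi>)"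
| "rename \<rho> (CMinus \<phi> \<psi>) = CMinus (rename \<rho> \<phi>) (rename \<rho> \<psi>)"
| "rename \<rho> (CSup x \<phi>) = CSup (fresh_for (\<rho> ` cfv \<phi>)) (rename (\<rho>(x := fresh_for (\<rho> ` cfv \<phi>))) \<phi>)"
| "rename \<rho> (CInf x \<phi>) = CInf (fresh_for (\<rho> ` cfv \<phi>)) (rename (\<rho>(x := fresh_for (\<rho> ` cfv \<phi>))) \<phi>)"

lemma cwf_rename: "cwf \<sigma> (rename \<rho> \<phi>) = cwf \<sigma> \<phi>"
  by (induction \<phi> arbitrary: \<rho>) (auto simp: wft_rename_trm list_all_iff)

lemma cfv_rename: "cfv (rename \<rho> \<phi>) \<subseteq> \<rho> ` cfv \<phi>"
proof (induction \<phi> arbitrary: \<rho>)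
  case (CSup x \<phi>)
  let ?y = "fresh_for (\<rho> ` cfv \<phi>)"
  have "(\<rho>(x := ?y)) ` cfv \<phi> \<subseteq> insert ?y (\<rho> ` (cfv \<phi> - {x}))" by auto
  then have "cfv (rename (\<rho>(x := ?y)) \<phi>) - {?y} \<subseteq> \<rho> ` (cfv \<phi> - {x})"
    using CSup[of "\<rho>(x := ?y)"] by blast
  then show ?case by simp
next
  case (CInf x \<phi>)
  let ?y = "fresh_for (\<rho> ` cfv \<phi>)"
  have "(\<rho>(x := ?y)) ` cfv \<phi> \<subseteq> insert ?y (\<rho> ` (cfv \<phi> - {x}))" by auto
  then have "cfv (rename (\<rho>(x := ?y)) \<phi>) - {?y} \<subseteq> \<rho> ` (cfv \<phi> - {x})"
    using CInf[of "\<rho>(x := ?y)"] by blast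
  then show ?case by simp
next
  case (CMinus \<phi> \<psi>)
  then show ?case unfolding rename.simps cfv.simps image_Un by (intro Un_mono)
qed (auto simp: fvt_rename_trm)

text \<open>No free variable of \<open>\<phi>\<close> is sent to the fresh variable, so updating it
  does not disturb what \<open>\<rho>\<close> reads from \<open>s\<close>.\<close>

lemma feval_rename_fresh:
  "feval M (s(fresh_for (\<rho> ` cfv \<phi>) := m) \<circ> \<rho>(x := fresh_for (\<rho> ` cfv \<phi>))) \<phi>
    = feval M ((s \<circ> \<rho>)(x := m)) \<phi>"
proof (rule feval_cong)
  fix v assume "v \<in> cfv \<phi>"
  then have "\<rho> v \<noteq> fresh_for (\<rho> ` cfv \<phi>)"
    using fresh_for[of "\<rho> ` cfv \<phi>"] finite_cfv[of \<phi>] by (metis finite_imageI imageI)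
  then show "(s(fresh_for (\<rho> ` cfv \<phi>) := m) \<circ> \<rho>(x := fresh_for (\<rho> ` cfv \<phi>))) v = ((s \<circ> \<rho>)(x := m)) v"
    by simp
qed

lemma feval_rename: "feval M s (rename \<rho> \<phi>) = feval M (s \<circ> \<rho>) \<phi>"
proof (induction \<phi> arbitrary: s \<rho>)
  case (CRel R ts)
  then show ?case by (simp add: tev_rename_trm o_def)
next
  case (CDist t u)
  then show ?case by (simp add: tev_rename_trm o_def)
next
  case (CSup x \<phi>)
  show ?case by (simp only: rename.simps feval.simps CSup feval_rename_fresh)
next
  case (CInf x \<phi>)
  show ?case by (simp only: rename.simps feval.simps CInf feval_rename_fresh)
qed simp_all

section \<open>Constants and bump functions as formulas\<close>

text \<open>Halving gives the lower half of the next dyadic level, and negation reflects it onto the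
  upper half.\<close>

lemma dyadic_formula:
  "k \<le> 2 ^ n \<Longrightarrow> \<exists>\<phi> :: ('g,'s) cfml. cwf \<sigma> \<phi> \<and> cfv \<phi> = {} \<and>
     (\<forall>(M :: ('m,'g,'s) mstruct) s. feval M s \<phi> = real k / 2 ^ n)"
proof (induction n arbitrary: k)
  case 0
  then have "k = 0 \<or> k = 1" by auto
  then show ?case
    by (auto intro: exI[of _ COne] exI[of _ "CNeg COne"])
next
  case (Suc n)
  have half: "\<exists>\<phi> :: ('g,'s) cfml. cwf \<sigma> \<phi> \<and> cfv \<phi> = {} \<and>
     (\<forall>(M :: ('m,'g,'s) mstruct) s. feval M s \<phi> = real k / 2 ^ Suc n)" if "k \<le> 2 ^ n" for k
  proof -
    obtain \<phi> :: "('g,'s) cfml" where "cwf \<sigma> \<phi> \<and> cfv \<phi> = {} \<and>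
     (\<forall>(M :: ('m,'g,'s) mstruct) s. feval M s \<phi> = real k / 2 ^ n)" using Suc.IH \<open>k \<le> _\<close> by blast
    then show ?thesis by (intro exI[of _ "CHalf \<phi>"]) (simp add: field_simps)
  qed
  show ?case
  proof (cases "k \<le> 2 ^ n")
    case True
    then show ?thesis by (rule half)
  next
    case False
    then have "2 ^ Suc n - k \<le> 2 ^ n" by simp
    then obtain \<phi> :: "('g,'s) cfml" where \<phi>: "cwf \<sigma> \<phi> \<and> cfv \<phi> = {} \<and>
     (\<forall>(M :: ('m,'g,'s) mstruct) s. feval M s \<phi> = real (2 ^ Suc n - k) / 2 ^ Suc n)"
      using half by blast
    have "real (2 ^ Suc n - k) = 2 ^ Suc n - real k"
      using Suc.prems by (simp add: of_nat_diff)
    then have "1 - real (2 ^ Suc n - k) / 2 ^ Suc n = real k / 2 ^ Suc n"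
      by (simp add: field_simps)
    then show ?thesis
      using \<phi> by (intro exI[of _ "CNeg \<phi>"]) simp
  qed
qed

lemma constant_formula_dense:
  fixes M :: "('m,'g,'s) mstruct"
  assumes "0 \<le> x" "x \<le> 1" "0 < e"
  shows "\<exists>\<phi> :: ('g,'s) cfml. \<exists>c. cwf \<sigma> \<phi> \<and> cfv \<phi> = {} \<and> (\<forall>s. feval M s \<phi> = c) \<and> \<bar>c - x\<bar> < e"
proof -
  obtain n where n: "(1/2) ^ n < e"
    using real_arch_pow_inv[OF assms(3), of "1/2"] by auto
  define k where "k = nat \<lfloor>x * 2 ^ n\<rfloor>"
  have k: "real k \<le> x * 2 ^ n" "x * 2 ^ n < real k + 1"
    unfolding k_def using assms(1) by (auto simp: of_nat_nat)
  have "x * 2 ^ n \<le> 2 ^ n" using assms(2) by simp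
  then have "real k \<le> 2 ^ n" using k(1) by linarith
  then have "k \<le> 2 ^ n" by (metis of_nat_le_iff of_nat_numeral of_nat_power)
  then obtain \<phi> :: "('g,'s) cfml" where "cwf \<sigma> \<phi> \<and> cfv \<phi> = {} \<and>
     (\<forall>(M :: ('m,'g,'s) mstruct) s. feval M s \<phi> = real k / 2 ^ n)"
    using dyadic_formula by blast
  moreover have "\<bar>real k / 2 ^ n - x\<bar> < e"
  proof -
    have "real k / 2 ^ n \<le> x" "x < real k / 2 ^ n + (1/2) ^ n"
      using k by (auto simp: field_simps power_divide)
    then show ?thesis using n by simp
  qed
  ultimately show ?thesis by blast
qed

text \<open>The formula is a minimum of tents, one for each \<open>\<phi>\<close>, centred near
  \<open>r \<phi>\<close>. Constant formulas only approximate the wanted centres and heights, and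
  the margins absorb this error.\<close>

lemma bump_formula:
  fixes M :: "('m,'g,'s) mstruct" and \<Delta> :: "('g,'s) cfml set"
  assumes ok: "mstruct_ok \<sigma> M" and "finite \<Delta>" and "\<forall>\<phi>\<in>\<Delta>. cwf \<sigma> \<phi> \<and> cfv \<phi> \<subseteq> V" and e: "0 < e"
    and "\<forall>\<phi>\<in>\<Delta>. r \<phi> \<in> {0..1}"
  shows "\<exists>\<psi>. cwf \<sigma> \<psi> \<and> cfv \<psi> \<subseteq> V \<and>
    (\<forall>s. (\<exists>\<phi>\<in>\<Delta>. \<bar>r \<phi> - feval M s \<phi>\<bar> > e) \<longrightarrow> feval M s \<psi> = 0) \<and>
    (\<forall>s. (\<forall>\<phi>\<in>\<Delta>. feval M s \<phi> = r \<phi>) \<longrightarrow> feval M s \<psi> > 0)"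
  using assms(2,3,5)
proof (induction \<Delta> rule: finite_induct)
  case empty
  show ?case by (rule exI[of _ COne]) simp
next
  case (insert \<phi> \<Delta>)
  then obtain \<psi> where \<psi>: "cwf \<sigma> \<psi>" "cfv \<psi> \<subseteq> V"
    "\<And>s. (\<exists>\<phi>\<in>\<Delta>. \<bar>r \<phi> - feval M s \<phi>\<bar> > e) \<Longrightarrow> feval M s \<psi> = 0"
    "\<And>s. (\<forall>\<phi>\<in>\<Delta>. feval M s \<phi> = r \<phi>) \<Longrightarrow> feval M s \<psi> > 0" by auto
  \<comment> \<open>The cap keeps the intended height \<open>d / 2\<close> in the unit interval.
    With errors below \<open>d / 4\<close>, the tent is positive at \<open>r \<phi>\<close>; beyond
    distance \<open>e\<close> from it the distance to \<open>c\<close> exceeds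
    \<open>3 * d / 4\<close>, hence the height.\<close>
  define d where "d = min e 1"
  have d: "0 < d" "d \<le> e" "d \<le> 1" using e unfolding d_def by auto
  obtain C :: "('g,'s) cfml" and c where C: "cwf \<sigma> C" "cfv C = {}" "\<And>s. feval M s C = c" "\<bar>c - r \<phi>\<bar> < d / 4"
    using constant_formula_dense[of "r \<phi>" "d / 4" \<sigma> M] insert.prems(2) d by auto
  obtain D :: "('g,'s) cfml" and d' where D: "cwf \<sigma> D" "cfv D = {}" "\<And>s. feval M s D = d'" "\<bar>d' - d / 2\<bar> < d / 4"
    using constant_formula_dense[of "d / 2" "d / 4" \<sigma> M] d by auto
  \<comment> \<open>One of the two truncated differences is always 0, so subtracting both subtracts
    the absolute value.\<close>
  define \<theta> where "\<theta> = CMinus (CMinus D (CMinus \<phi> C)) (CMinus C \<phi>)"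
  have \<theta>: "feval M s \<theta> = max 0 (d' - \<bar>feval M s \<phi> - c\<bar>)" for s
    unfolding \<theta>_def by (simp add: C D)
  have m: "feval M s (CMinus \<psi> (CMinus \<psi> \<theta>)) = min (feval M s \<psi>) (feval M s \<theta>)" for s
    using feval_bounds[OF ok \<psi>(1), of s] \<theta>[of s] by (auto simp: max_def min_def)
  show ?case
  proof (intro exI[of _ "CMinus \<psi> (CMinus \<psi> \<theta>)"] conjI allI impI)
    show "cwf \<sigma> (CMinus \<psi> (CMinus \<psi> \<theta>))" "cfv (CMinus \<psi> (CMinus \<psi> \<theta>)) \<subseteq> V"
      using \<psi> C D insert.prems unfolding \<theta>_def by auto
  next
    fix s assume "\<exists>\<phi>'\<in>insert \<phi> \<Delta>. \<bar>r \<phi>' - feval M s \<phi>'\<bar> > e"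
    then have "feval M s \<psi> = 0 \<or> \<bar>r \<phi> - feval M s \<phi>\<bar> > e" using \<psi>(3)[of s] by blast
    then have "feval M s \<psi> = 0 \<or> feval M s \<theta> = 0"
      using C(4) D(4) d unfolding \<theta> by (auto simp: max_def abs_if split: if_splits)
    then show "feval M s (CMinus \<psi> (CMinus \<psi> \<theta>)) = 0"
      using feval_bounds[OF ok \<psi>(1), of s] unfolding m \<theta> by auto
  next
    fix s assume *: "\<forall>\<phi>'\<in>insert \<phi> \<Delta>. feval M s \<phi>' = r \<phi>'"
    then have "feval M s \<psi> > 0" using \<psi>(4) by blast
    moreover have "feval M s \<theta> > 0"
      using * C(4) D(4) d unfolding \<theta> by (auto simp: max_def abs_if split: if_splits)
    ultimately show "feval M s (CMinus \<psi> (CMinus \<psi> \<theta>)) > 0" unfolding m by simp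
  qed
qed

subsection \<open>Realizing types in many variables\<close>

text \<open>Functions on \<open>'i\<close>-indexed sequences given by a formula whose variables are sequence entries
  with index in \<open>X\<close>; this replaces formulas in \<open>'i\<close>-many variables.\<close>
definition definable ::
  "('g,'s) csig \<Rightarrow> ('m,'g,'s) mstruct \<Rightarrow> 'i set \<Rightarrow> (('i \<Rightarrow> 'm) \<Rightarrow> real) \<Rightarrow> bool" where
  "definable \<sigma> M X P \<longleftrightarrow>
     (\<exists>\<phi> \<rho>. cwf \<sigma> \<phi> \<and> \<rho> ` cfv \<phi> \<subseteq> X \<and> (\<forall>b. P b = feval M (b \<circ> \<rho>) \<phi>))"

lemma definableE:
  assumes "definable \<sigma> M X P"
  obtains \<phi> \<rho> where "cwf \<sigma> \<phi>" "\<rho> ` cfv \<phi> \<subseteq> X" "\<And>b. P b = feval M (b \<circ> \<rho>) \<phi>"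
  using assms unfolding definable_def by blast

lemma definableI:
  "cwf \<sigma> \<phi> \<Longrightarrow> \<rho> ` cfv \<phi> \<subseteq> X \<Longrightarrow> (\<And>b. P b = feval M (b \<circ> \<rho>) \<phi>) \<Longrightarrow> definable \<sigma> M X P"
  unfolding definable_def by blast

lemma definable_mono: "definable \<sigma> M X P \<Longrightarrow> X \<subseteq> Y \<Longrightarrow> definable \<sigma> M Y P"
  unfolding definable_def by blast

lemma definable_bounds: "mstruct_ok \<sigma> M \<Longrightarrow> definable \<sigma> M X P \<Longrightarrow> P b \<in> {0..1}"
  by (metis definableE feval_bounds)

lemma definable_cong:
  assumes "definable \<sigma> M X P" "\<And>i. i \<in> X \<Longrightarrow> b i = c i"
  shows "P b = P c"
proof -
  obtain \<phi> \<rho> where "\<rho> ` cfv \<phi> \<subseteq> X" "\<And>b. P b = feval M (b \<circ> \<rho>) \<phi>"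
    using assms(1) by (rule definableE) blast
  then show ?thesis using assms(2) by (auto intro!: feval_cong)
qed

lemma definable_finite_support:
  assumes "definable \<sigma> M X P"
  shows "\<exists>Y. finite Y \<and> definable \<sigma> M Y P"
proof -
  obtain \<phi> \<rho> where "cwf \<sigma> \<phi>" "\<And>b. P b = feval M (b \<circ> \<rho>) \<phi>"
    using assms by (rule definableE) blast
  then show ?thesis by (intro exI[of _ "\<rho> ` cfv \<phi>"]) (auto simp: finite_cfv intro: definableI)
qed

lemma definable_one: "definable \<sigma> M X (\<lambda>b. 1)"
  by (rule definableI[of _ COne]) auto

lemma definable_neg: "definable \<sigma> M X P \<Longrightarrow> definable \<sigma> M X (\<lambda>b. 1 - P b)"
  by (elim definableE, rule definableI[of _ "CNeg _"]) auto

lemma definable_minus: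
  fixes M :: "('m,'g,'s) mstruct" and P :: "('i \<Rightarrow> 'm) \<Rightarrow> real"
  assumes "definable \<sigma> M X P" "definable \<sigma> M X Q"
  shows "definable \<sigma> M X (\<lambda>b. max 0 (P b - Q b))"
proof -
  obtain \<phi> \<rho> where \<phi>: "cwf \<sigma> \<phi>" "\<rho> ` cfv \<phi> \<subseteq> X" "\<And>b. P b = feval M (b \<circ> \<rho>) \<phi>"
    using assms(1) by (rule definableE) blast
  obtain \<psi> \<rho>' where \<psi>: "cwf \<sigma> \<psi>" "\<rho>' ` cfv \<psi> \<subseteq> X" "\<And>b. Q b = feval M (b \<circ> \<rho>') \<psi>"
    using assms(2) by (rule definableE) blast
  \<comment> \<open>Even and odd variables keep apart the two formulas, which come with different
    assignments.\<close>
  let ?\<phi> = "rename (\<lambda>n. 2 * n) \<phi>" and ?\<psi> = "rename (\<lambda>n. 2 * n + 1) \<psi>"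
  let ?\<rho> = "\<lambda>k. if even k then \<rho> (k div 2) else \<rho>' (k div 2)"
  have comp: "b \<circ> ?\<rho> \<circ> (\<lambda>n. 2 * n) = b \<circ> \<rho>" "b \<circ> ?\<rho> \<circ> (\<lambda>n. 2 * n + 1) = b \<circ> \<rho>'" for b :: "'i \<Rightarrow> 'm"
    by (auto simp: fun_eq_iff)
  show ?thesis
  proof (rule definableI)
    show "cwf \<sigma> (CMinus ?\<phi> ?\<psi>)" using \<phi> \<psi> by (simp add: cwf_rename)
    have "?\<rho> v \<in> X" if "v \<in> cfv ?\<phi>" for v
      using that cfv_rename[of "\<lambda>n. 2 * n" \<phi>] \<phi>(2)[unfolded image_subset_iff] by auto
    moreover have "?\<rho> v \<in> X" if "v \<in> cfv ?\<psi>" for v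
      using that cfv_rename[of "\<lambda>n. 2 * n + 1" \<psi>] \<psi>(2)[unfolded image_subset_iff] by auto
    ultimately show "?\<rho> ` cfv (CMinus ?\<phi> ?\<psi>) \<subseteq> X"
      unfolding cfv.simps by blast
    show "max 0 (P b - Q b) = feval M (b \<circ> ?\<rho>) (CMinus ?\<phi> ?\<psi>)" for b
      unfolding feval.simps feval_rename comp \<phi>(3) \<psi>(3) ..
  qed
qed

lemma definable_max:
  assumes ok: "mstruct_ok \<sigma> M" and P: "definable \<sigma> M X P" and Q: "definable \<sigma> M X Q"
  shows "definable \<sigma> M X (\<lambda>b. max (P b) (Q b))"
proof -
  \<comment> \<open>In the unit interval the maximum is \<open>P\<close> plus the truncated
    difference, and addition is expressed by subtracting from the negation.\<close>
  have "max (P b) (Q b) = 1 - max 0 ((1 - P b) - max 0 (Q b - P b))" for b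
    using definable_bounds[OF ok P, of b] definable_bounds[OF ok Q, of b] by (auto simp: max_def)
  then show ?thesis
    using definable_neg[OF definable_minus[OF definable_neg[OF P] definable_minus[OF Q P]]] by simp
qed

text \<open>All variables standing for entry \<open>i\<close> are merged into variable 0, in which
  saturation is stated, and the others are shifted. This merging is the reason for allowing
  non-injective renamings.\<close>

lemma definable_separate_variable:
  fixes M :: "('m,'g,'s) mstruct" and P :: "('i \<Rightarrow> 'm) \<Rightarrow> real"
  assumes "definable \<sigma> M X P"
  obtains \<phi> \<rho> where "cwf \<sigma> \<phi>" "\<rho> ` (cfv \<phi> - {0}) \<subseteq> X - {i}"
    "\<And>b m. P (b(i := m)) = feval M ((b \<circ> \<rho>)(0 := m)) \<phi>"
proof -
  obtain \<phi> \<rho> where \<phi>: "cwf \<sigma> \<phi>" "\<rho> ` cfv \<phi> \<subseteq> X" "\<And>b. P b = feval M (b \<circ> \<rho>) \<phi>"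
    using assms by (rule definableE) blast
  let ?f = "\<lambda>v. if \<rho> v = i then 0 else Suc v" and ?\<rho> = "\<lambda>v. \<rho> (v - 1)"
  show ?thesis
  proof
    show "cwf \<sigma> (rename ?f \<phi>)" using \<phi> by (simp add: cwf_rename)
    show "?\<rho> ` (cfv (rename ?f \<phi>) - {0}) \<subseteq> X - {i}"
      using cfv_rename[of ?f \<phi>] \<phi>(2) by (fastforce split: if_splits)
    have "(b \<circ> ?\<rho>)(0 := m) \<circ> ?f = b(i := m) \<circ> \<rho>" for b :: "'i \<Rightarrow> 'm" and m
      by (auto simp: fun_eq_iff)
    then show "P (b(i := m)) = feval M ((b \<circ> ?\<rho>)(0 := m)) (rename ?f \<phi>)" for b m
      unfolding feval_rename \<phi>(3) by simp
  qed
qed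

lemma definable_Inf:
  assumes "definable \<sigma> M X P"
  shows "definable \<sigma> M (X - {i}) (\<lambda>b. INF m. P (b(i := m)))"
proof -
  obtain \<phi> \<rho> where \<phi>: "cwf \<sigma> \<phi>" "\<rho> ` (cfv \<phi> - {0}) \<subseteq> X - {i}"
    "\<And>b m. P (b(i := m)) = feval M ((b \<circ> \<rho>)(0 := m)) \<phi>"
    using assms by (rule definable_separate_variable[where i = i]) blast
  show ?thesis
    by (rule definableI[of _ "CInf 0 \<phi>" \<rho>]) (use \<phi> in simp_all)
qed

text \<open>The bound \<open>e\<close> is nonnegative because the maximum of an empty family is
  taken to be 0.\<close>

lemma definable_finite_max:
  assumes ok: "mstruct_ok \<sigma> M" and "finite F" and "\<forall>P\<in>F. definable \<sigma> M X P"
  shows "\<exists>Q. definable \<sigma> M X Q \<and> (\<forall>b. \<forall>P\<in>F. P b \<le> Q b) \<and>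
    (\<forall>b e. 0 \<le> e \<longrightarrow> (\<forall>P\<in>F. P b \<le> e) \<longrightarrow> Q b \<le> e)"
  using assms(2,3)
proof (induction F rule: finite_induct)
  case empty
  then show ?case using definable_neg[OF definable_one, of \<sigma> M X] by (intro exI[of _ "\<lambda>b. 1 - 1"]) auto
next
  case (insert P F)
  then obtain Q where "definable \<sigma> M X Q" "\<forall>b. \<forall>P\<in>F. P b \<le> Q b"
    "\<forall>b e. 0 \<le> e \<longrightarrow> (\<forall>P\<in>F. P b \<le> e) \<longrightarrow> Q b \<le> e" by auto
  then show ?case
    using insert.prems definable_max[OF ok, of X P Q]
    by (intro exI[of _ "\<lambda>b. max (P b) (Q b)"]) (auto simp: le_max_iff_disj)
qed

text \<open>\<open>Q\<close> is the iterated infimum over the entries in \<open>Y\<close>. Infima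
  need not be attained, so it is described by a lower bound and an approximation, whose error is
  halved at each entry.\<close>

lemma definable_finite_Inf:
  fixes M :: "('m,'g,'s) mstruct" and P :: "('i \<Rightarrow> 'm) \<Rightarrow> real"
  assumes ok: "mstruct_ok \<sigma> M" and "finite Y" and P: "definable \<sigma> M X P"
  shows "\<exists>Q. definable \<sigma> M (X - Y) Q \<and> (\<forall>b c. (\<forall>i. i \<notin> Y \<longrightarrow> c i = b i) \<longrightarrow> Q b \<le> P c) \<and>
    (\<forall>b e. 0 < e \<longrightarrow> (\<exists>c. (\<forall>i. i \<notin> Y \<longrightarrow> c i = b i) \<and> P c \<le> Q b + e))"
  using assms(2)
proof (induction Y rule: finite_induct)
  case empty
  have "c = b" if "\<forall>i. c i = b i" for b c :: "'i \<Rightarrow> 'm" using that by auto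
  then show ?case using P by (intro exI[of _ P]) (auto intro: exI[of _ "_ :: 'i \<Rightarrow> 'm"])
next
  case (insert j Y)
  then obtain Q where Q: "definable \<sigma> M (X - Y) Q"
    "\<And>b c. (\<forall>i. i \<notin> Y \<longrightarrow> c i = b i) \<Longrightarrow> Q b \<le> P c"
    "\<And>b e. 0 < e \<Longrightarrow> (\<exists>c. (\<forall>i. i \<notin> Y \<longrightarrow> c i = b i) \<and> P c \<le> Q b + e)" by blast
  let ?Q = "\<lambda>b. INF m. Q (b(j := m))"
  have bdd: "bdd_below (range (\<lambda>m. Q (b(j := m))))" for b
    using definable_bounds[OF ok Q(1)] by (auto intro!: bdd_belowI[of _ 0])
  show ?case
  proof (intro exI[of _ ?Q] conjI allI impI)
    show "definable \<sigma> M (X - insert j Y) ?Q"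
      unfolding Diff_insert[of X j Y] using Q(1) by (rule definable_Inf)
  next
    fix b c :: "'i \<Rightarrow> 'm" assume "\<forall>i. i \<notin> insert j Y \<longrightarrow> c i = b i"
    then have "Q (b(j := c j)) \<le> P c" by (intro Q(2)) auto
    moreover have "?Q b \<le> Q (b(j := c j))" using bdd by (intro cINF_lower) auto
    ultimately show "?Q b \<le> P c" by simp
  next
    fix b :: "'i \<Rightarrow> 'm" and e :: real assume e: "0 < e"
    then have "?Q b < ?Q b + e / 2" by simp
    then obtain m where m: "Q (b(j := m)) < ?Q b + e / 2"
      unfolding cINF_less_iff[OF UNIV_not_empty bdd] by blast
    obtain c where "\<forall>i. i \<notin> Y \<longrightarrow> c i = (b(j := m)) i" "P c \<le> Q (b(j := m)) + e / 2"
      using Q(3)[of "e / 2" "b(j := m)"] e by auto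
    then show "\<exists>c. (\<forall>i. i \<notin> insert j Y \<longrightarrow> c i = b i) \<and> P c \<le> ?Q b + e"
      using m by (intro exI[of _ c]) auto
  qed
qed

lemma csaturated_definable:
  fixes M :: "('m,'g,'s) mstruct" and b :: "'i \<Rightarrow> 'm"
  assumes sat: "csaturated \<sigma> M (UNIV :: 'i set)"
    and q: "\<forall>Q\<in>q. definable \<sigma> M (insert i J) Q"
    and fin: "\<And>F e. finite F \<Longrightarrow> F \<subseteq> q \<Longrightarrow> 0 < e \<Longrightarrow> \<exists>m. \<forall>Q\<in>F. Q (b(i := m)) \<le> e"
  shows "\<exists>m. \<forall>Q\<in>q. Q (b(i := m)) = 0"
proof -
  have *: "\<forall>Q\<in>q. \<exists>ps. cwf \<sigma> (fst ps) \<and> (\<forall>v \<in> cfv (fst ps) - {0}. snd ps v \<in> b ` J) \<and>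
    (\<forall>m. Q (b(i := m)) = feval M ((snd ps)(0 := m)) (fst ps))"
  proof
    fix Q assume "Q \<in> q"
    then have "definable \<sigma> M (insert i J) Q" using q by blast
    then obtain \<phi> \<rho> where "cwf \<sigma> \<phi>" "\<rho> ` (cfv \<phi> - {0}) \<subseteq> insert i J - {i}"
      "\<And>b m. Q (b(i := m)) = feval M ((b \<circ> \<rho>)(0 := m)) \<phi>"
      by (rule definable_separate_variable[where i = i]) blast
    then show "\<exists>ps. cwf \<sigma> (fst ps) \<and> (\<forall>v \<in> cfv (fst ps) - {0}. snd ps v \<in> b ` J) \<and>
      (\<forall>m. Q (b(i := m)) = feval M ((snd ps)(0 := m)) (fst ps))"
      by (intro exI[of _ "(\<phi>, b \<circ> \<rho>)"]) auto
  qed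
  obtain f where f: "\<forall>Q\<in>q. cwf \<sigma> (fst (f Q)) \<and> (\<forall>v \<in> cfv (fst (f Q)) - {0}. snd (f Q) v \<in> b ` J) \<and>
    (\<forall>m. Q (b(i := m)) = feval M ((snd (f Q))(0 := m)) (fst (f Q)))"
    using bchoice[OF *] by (rule exE)
  \<comment> \<open>The parameters are entries with index in \<open>J\<close>; choosing an index for
    each bounds their number by the size of \<open>'i\<close>.\<close>
  have 1: "\<exists>g :: 'm \<Rightarrow> 'i. inj_on g (b ` J) \<and> g ` b ` J \<subseteq> UNIV"
    by (intro exI[of _ "inv_into J b"]) (simp add: inj_on_inv_into)
  have 2: "\<forall>(\<phi>, s) \<in> f ` q. cwf \<sigma> \<phi> \<and> (\<forall>v \<in> cfv \<phi> - {0}. s v \<in> b ` J)"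
    using f by (auto simp: case_prod_beta)
  have 3: "\<forall>p0 \<subseteq> f ` q. finite p0 \<longrightarrow> (\<forall>e>0. \<exists>m. \<forall>(\<phi>, s) \<in> p0. feval M (s(0 := m)) \<phi> \<le> e)"
  proof (intro allI impI)
    fix p0 and e :: real assume "p0 \<subseteq> f ` q" "finite p0" "0 < e"
    then obtain F where F: "F \<subseteq> q" "finite F" "p0 = f ` F"
      by (meson finite_subset_image)
    obtain m where "\<forall>Q\<in>F. Q (b(i := m)) \<le> e" using fin[OF F(2,1) \<open>0 < e\<close>] by blast
    then show "\<exists>m. \<forall>(\<phi>, s) \<in> p0. feval M (s(0 := m)) \<phi> \<le> e"
      using f F(1) unfolding F(3) by (intro exI[of _ m]) (auto simp: case_prod_beta)
  qed
  obtain m where "\<forall>(\<phi>, s) \<in> f ` q. feval M (s(0 := m)) \<phi> = 0"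
    using sat[unfolded csaturated_def, THEN spec[of _ "b ` J"], THEN spec[of _ "f ` q"],
        THEN mp, OF 1, THEN mp, OF 2, THEN mp, OF 3]
    by (rule exE)
  then show ?thesis using f by (intro exI[of _ m]) (auto simp: case_prod_beta)
qed

text \<open>The Teichmueller-Tukey lemma: a finite subset of the union of a chain lies in one
  member, so Zorn's lemma applies.\<close>

lemma finite_character_maximal:
  assumes fc: "\<And>G. (\<And>G0. finite G0 \<Longrightarrow> G0 \<subseteq> G \<Longrightarrow> Good G0) \<Longrightarrow> Good G"
    and mono: "\<And>G G0. Good G \<Longrightarrow> G0 \<subseteq> G \<Longrightarrow> Good G0" and ne: "Good {}"
  shows "\<exists>G. Good G \<and> (\<forall>x. Good (insert x G) \<longrightarrow> x \<in> G)"
proof -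
  have "\<exists>M\<in>Collect Good. \<forall>X\<in>Collect Good. M \<subseteq> X \<longrightarrow> X = M"
  proof (rule subset_Zorn_nonempty)
    show "Collect Good \<noteq> {}" using ne by blast
    fix C assume C: "C \<noteq> {}" "subset.chain (Collect Good) C"
    have "Good (\<Union>C)"
    proof (rule fc)
      fix G0 assume "finite G0" "G0 \<subseteq> \<Union>C"
      then obtain G where "G \<in> C" "G0 \<subseteq> G"
        using C by (rule finite_subset_Union_chain)
      then show "Good G0" using C(2) mono unfolding subset_chain_def by blast
    qed
    then show "\<Union>C \<in> Collect Good" by simp
  qed
  then obtain G where "Good G" and max: "\<And>X. Good X \<Longrightarrow> G \<subseteq> X \<Longrightarrow> X = G" by blast
  moreover have "x \<in> G" if "Good (insert x G)" for x
    using max[OF that] by blast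
  ultimately show ?thesis by blast
qed

text \<open>Maximal partial realizations are total: to add an entry, quantify out the entries that are
  not yet fixed and apply saturation to the resulting type in one variable.\<close>
lemma realize_definable:
  fixes M :: "('m,'g,'s) mstruct" and p :: "(('i \<Rightarrow> 'm) \<Rightarrow> real) set"
  assumes ok: "mstruct_ok \<sigma> M" and sat: "csaturated \<sigma> M (UNIV :: 'i set)"
    and p: "\<forall>P\<in>p. definable \<sigma> M UNIV P"
    and fin: "\<And>F e. finite F \<Longrightarrow> F \<subseteq> p \<Longrightarrow> 0 < e \<Longrightarrow> \<exists>c. \<forall>P\<in>F. P c \<le> e"
  shows "\<exists>b. \<forall>P\<in>p. P b = 0"
proof -
  \<comment> \<open>\<open>G\<close> is the graph of a partial sequence. Asking only for approximate
    solutions of finite parts gives the property finite character.\<close>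
  define Good where "Good G \<longleftrightarrow> (\<forall>F G0 e. finite F \<and> F \<subseteq> p \<and> finite G0 \<and> G0 \<subseteq> G \<and> 0 < e \<longrightarrow>
    (\<exists>c. (\<forall>(i,m)\<in>G0. c i = m) \<and> (\<forall>P\<in>F. P c \<le> e)))" for G :: "('i \<times> 'm) set"
  have GoodD: "\<exists>c. (\<forall>(i,m)\<in>G0. c i = m) \<and> (\<forall>P\<in>F. P c \<le> e)"
    if "Good G" "finite F" "F \<subseteq> p" "finite G0" "G0 \<subseteq> G" "0 < e" for G F G0 and e :: real
    using that unfolding Good_def by blast
  have "\<exists>G. Good G \<and> (\<forall>x. Good (insert x G) \<longrightarrow> x \<in> G)"
  proof (rule finite_character_maximal)
    show "Good G" if "\<And>G0. finite G0 \<Longrightarrow> G0 \<subseteq> G \<Longrightarrow> Good G0" for G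
      unfolding Good_def
    proof (intro allI impI)
      fix F G0 and e :: real
      assume "finite F \<and> F \<subseteq> p \<and> finite G0 \<and> G0 \<subseteq> G \<and> 0 < e"
      then show "\<exists>c. (\<forall>(i,m)\<in>G0. c i = m) \<and> (\<forall>P\<in>F. P c \<le> e)"
        using GoodD[OF that[of G0]] by blast
    qed
    show "Good G0" if "Good G" "G0 \<subseteq> G" for G G0
      using that unfolding Good_def by (meson order_trans)
    show "Good {}"
      unfolding Good_def
    proof (intro allI impI)
      fix F and G0 :: "('i \<times> 'm) set" and e :: real
      assume "finite F \<and> F \<subseteq> p \<and> finite G0 \<and> G0 \<subseteq> {} \<and> 0 < e"
      then show "\<exists>c. (\<forall>(i,m)\<in>G0. c i = m) \<and> (\<forall>P\<in>F. P c \<le> e)"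
        using fin[of F e] by auto
    qed
  qed
  then obtain G where G: "Good G" and max: "\<And>x. Good (insert x G) \<Longrightarrow> x \<in> G" by blast
  have sv: "m = m'" if "(i, m) \<in> G" "(i, m') \<in> G" for i m m'
    using GoodD[OF G, of "{}" "{(i,m),(i,m')}" 1] that by auto
  define b where "b i = (SOME m. (i, m) \<in> G)" for i
  have b: "b i = m" if "(i, m) \<in> G" for i m
    using someI[of "\<lambda>m. (i, m) \<in> G" m] sv that unfolding b_def by blast
  have supp: "\<forall>P\<in>p. \<exists>Y. finite Y \<and> definable \<sigma> M Y P"
    using p definable_finite_support by blast
  obtain Y where Y: "\<forall>P\<in>p. finite (Y P) \<and> definable \<sigma> M (Y P) P"
    using bchoice[OF supp] by (rule exE)
  have approx: "\<exists>c. (\<forall>i\<in>X \<inter> Domain G. c i = b i) \<and> (\<forall>P\<in>F. P c \<le> e)"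
    if A: "finite X" "finite F" "F \<subseteq> p" "0 < e" for X F and e :: real
  proof -
    have fg: "finite ((\<lambda>i. (i, b i)) ` (X \<inter> Domain G))" "(\<lambda>i. (i, b i)) ` (X \<inter> Domain G) \<subseteq> G"
      using that(1) b by auto
    obtain c where "\<forall>(i,m)\<in>(\<lambda>i. (i, b i)) ` (X \<inter> Domain G). c i = m" "\<forall>P\<in>F. P c \<le> e"
      using GoodD[OF G A(2,3) fg A(4)] by (elim exE conjE)
    then show ?thesis by (intro exI[of _ c]) auto
  qed
  have total: "i \<in> Domain G" for i
  proof (rule ccontr)
    assume i: "i \<notin> Domain G"
    let ?J = "Domain G"
    let ?X = "\<lambda>F. \<Union>(Y ` F) - insert i ?J"
    \<comment> \<open>\<open>snd QR\<close> is the maximum of \<open>F\<close>, and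
      \<open>fst QR\<close> is the same with the entries of \<open>?X F\<close> quantified out,
      those used by \<open>F\<close> that are neither fixed yet nor equal to
      \<open>i\<close>.\<close>
    have *: "\<forall>F\<in>{F. finite F \<and> F \<subseteq> p}. \<exists>QR. definable \<sigma> M (\<Union>(Y ` F)) (snd QR) \<and>
       (\<forall>b. \<forall>P\<in>F. P b \<le> snd QR b) \<and> (\<forall>b e. 0 \<le> e \<longrightarrow> (\<forall>P\<in>F. P b \<le> e) \<longrightarrow> snd QR b \<le> e) \<and>
       definable \<sigma> M (insert i ?J) (fst QR) \<and>
       (\<forall>b c. (\<forall>i. i \<notin> ?X F \<longrightarrow> c i = b i) \<longrightarrow> fst QR b \<le> snd QR c) \<and>
       (\<forall>b e. 0 < e \<longrightarrow> (\<exists>c. (\<forall>i. i \<notin> ?X F \<longrightarrow> c i = b i) \<and> snd QR c \<le> fst QR b + e))"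
    proof
      fix F assume "F \<in> {F. finite F \<and> F \<subseteq> p}"
      then have F: "finite F" "F \<subseteq> p" by auto
      have "\<forall>P\<in>F. definable \<sigma> M (\<Union>(Y ` F)) P"
        using F Y by (blast intro: definable_mono)
      then obtain R where R: "definable \<sigma> M (\<Union>(Y ` F)) R" "\<forall>b. \<forall>P\<in>F. P b \<le> R b"
        "\<forall>b e. 0 \<le> e \<longrightarrow> (\<forall>P\<in>F. P b \<le> e) \<longrightarrow> R b \<le> e"
        using definable_finite_max[OF ok F(1)] by blast
      have "finite (?X F)" using F Y by auto
      then obtain Q where Q: "definable \<sigma> M (\<Union>(Y ` F) - ?X F) Q"
         "\<forall>b c. (\<forall>i. i \<notin> ?X F \<longrightarrow> c i = b i) \<longrightarrow> Q b \<le> R c"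
         "\<forall>b e. 0 < e \<longrightarrow> (\<exists>c. (\<forall>i. i \<notin> ?X F \<longrightarrow> c i = b i) \<and> R c \<le> Q b + e)"
        using definable_finite_Inf[OF ok _ R(1)] by blast
      have "definable \<sigma> M (insert i ?J) Q"
        using Q(1) by (rule definable_mono) auto
      then show "\<exists>QR. definable \<sigma> M (\<Union>(Y ` F)) (snd QR) \<and>
       (\<forall>b. \<forall>P\<in>F. P b \<le> snd QR b) \<and> (\<forall>b e. 0 \<le> e \<longrightarrow> (\<forall>P\<in>F. P b \<le> e) \<longrightarrow> snd QR b \<le> e) \<and>
       definable \<sigma> M (insert i ?J) (fst QR) \<and>
       (\<forall>b c. (\<forall>i. i \<notin> ?X F \<longrightarrow> c i = b i) \<longrightarrow> fst QR b \<le> snd QR c) \<and>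
       (\<forall>b e. 0 < e \<longrightarrow> (\<exists>c. (\<forall>i. i \<notin> ?X F \<longrightarrow> c i = b i) \<and> snd QR c \<le> fst QR b + e))"
        using R Q by (intro exI[of _ "(Q, R)"]) auto
    qed
    obtain QR where QR0: "\<forall>F\<in>{F. finite F \<and> F \<subseteq> p}. definable \<sigma> M (\<Union>(Y ` F)) (snd (QR F)) \<and>
       (\<forall>b. \<forall>P\<in>F. P b \<le> snd (QR F) b) \<and> (\<forall>b e. 0 \<le> e \<longrightarrow> (\<forall>P\<in>F. P b \<le> e) \<longrightarrow> snd (QR F) b \<le> e) \<and>
       definable \<sigma> M (insert i ?J) (fst (QR F)) \<and>
       (\<forall>b c. (\<forall>i. i \<notin> ?X F \<longrightarrow> c i = b i) \<longrightarrow> fst (QR F) b \<le> snd (QR F) c) \<and>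
       (\<forall>b e. 0 < e \<longrightarrow> (\<exists>c. (\<forall>i. i \<notin> ?X F \<longrightarrow> c i = b i) \<and> snd (QR F) c \<le> fst (QR F) b + e))"
      using bchoice[OF *] by (rule exE)
    define Q where "Q F = fst (QR F)" for F
    define R where "R F = snd (QR F)" for F
    have QR: "definable \<sigma> M (\<Union>(Y ` F)) (R F)" "\<And>b P. P \<in> F \<Longrightarrow> P b \<le> R F b"
       "\<And>b e. 0 \<le> e \<Longrightarrow> (\<And>P. P \<in> F \<Longrightarrow> P b \<le> e) \<Longrightarrow> R F b \<le> e"
       "definable \<sigma> M (insert i ?J) (Q F)"
       "\<And>b c. (\<And>i. i \<notin> ?X F \<Longrightarrow> c i = b i) \<Longrightarrow> Q F b \<le> R F c"
       "\<And>b e. 0 < e \<Longrightarrow> (\<exists>c. (\<forall>i. i \<notin> ?X F \<longrightarrow> c i = b i) \<and> R F c \<le> Q F b + e)"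
      if "finite F" "F \<subseteq> p" for F
      using bspec[OF QR0, of F] that unfolding Q_def R_def by auto
    let ?q = "Q ` {F. finite F \<and> F \<subseteq> p}"
    have "\<exists>m. \<forall>Q\<in>?q. Q (b(i := m)) = 0"
    proof (rule csaturated_definable[OF sat])
      show "\<forall>Q\<in>?q. definable \<sigma> M (insert i ?J) Q" using QR(4) by auto
      fix q0 and e :: real assume "finite q0" "q0 \<subseteq> ?q" "0 < e"
      then obtain FF where FF: "FF \<subseteq> {F. finite F \<and> F \<subseteq> p}" "finite FF" "q0 = Q ` FF"
        by (meson finite_subset_image)
      have fFF: "finite (\<Union>FF)" "\<Union>FF \<subseteq> p" "finite (\<Union>(Y ` \<Union>FF))" using FF Y by auto
      obtain c where c: "\<forall>i\<in>\<Union>(Y ` \<Union>FF) \<inter> ?J. c i = b i" "\<forall>P\<in>\<Union>FF. P c \<le> e"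
        using approx[OF fFF(3,1,2) \<open>0 < e\<close>] by (elim exE conjE)
      have "Q F (b(i := c i)) \<le> e" if "F \<in> FF" for F
      proof -
        have F: "finite F" "F \<subseteq> p" using FF that by auto
        \<comment> \<open>Free entries come from \<open>c\<close>, all others from the partial
          sequence with \<open>c i\<close> added; on the support of \<open>F\<close> this coincides
          with \<open>c\<close>.\<close>
        let ?c = "\<lambda>j. if j \<in> ?X F then c j else (b(i := c i)) j"
        have "Q F (b(i := c i)) \<le> R F ?c"
          using F by (intro QR(5)) auto
        also have "R F ?c = R F c"
          using QR(1)[OF F]
        proof (rule definable_cong)
          fix j assume j: "j \<in> \<Union>(Y ` F)"
          have "c j = b j" if "j \<in> ?J" using c(1) j that \<open>F \<in> FF\<close> by blast
          then show "?c j = c j" using j by auto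
        qed
        also have "R F c \<le> e"
          using F c(2) that \<open>0 < e\<close> by (intro QR(3)) auto
        finally show ?thesis .
      qed
      then show "\<exists>m. \<forall>Q\<in>q0. Q (b(i := m)) \<le> e"
        using FF by (intro exI[of _ "c i"]) auto
    qed
    then obtain m where m: "\<And>F. finite F \<Longrightarrow> F \<subseteq> p \<Longrightarrow> Q F (b(i := m)) = 0" by auto
    have "Good (insert (i, m) G)"
      unfolding Good_def
    proof (intro allI impI)
      fix F G0 and e :: real
      assume *: "finite F \<and> F \<subseteq> p \<and> finite G0 \<and> G0 \<subseteq> insert (i, m) G \<and> 0 < e"
      \<comment> \<open>The infimum over the free entries is 0 at \<open>m\<close>, so they can be
        filled in with error at most \<open>e\<close>.\<close>
      then obtain c where c: "\<forall>j. j \<notin> ?X F \<longrightarrow> c j = (b(i := m)) j" "R F c \<le> e"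
        using QR(6)[of F e "b(i := m)"] m[of F] by auto
      have "c j = k" if "(j, k) \<in> G0" for j k
      proof -
        have "(j, k) = (i, m) \<or> (j, k) \<in> G" using that * by blast
        then show ?thesis
        proof
          assume "(j, k) \<in> G"
          then have "j \<notin> ?X F" "j \<noteq> i" using i by auto
          then show ?thesis using c(1)[rule_format, of j] b[OF \<open>(j, k) \<in> G\<close>] by simp
        qed (use c(1) in simp)
      qed
      moreover have "P c \<le> e" if "P \<in> F" for P
        using QR(2)[of F P c] * that c(2) by simp
      ultimately show "\<exists>c. (\<forall>(i,m)\<in>G0. c i = m) \<and> (\<forall>P\<in>F. P c \<le> e)" by blast
    qed
    then have "(i, m) \<in> G" by (rule max)
    then show False using i by blast
  qed
  have "P b = 0" if "P \<in> p" for P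
  proof -
    have Y': "finite (Y P)" "definable \<sigma> M (Y P) P" using Y that by auto
    have "P b \<le> e" if "0 < e" for e :: real
    proof -
      obtain c where c: "\<forall>i\<in>Y P \<inter> Domain G. c i = b i" "P c \<le> e"
        using approx[of "Y P" "{P}" e] Y'(1) \<open>P \<in> p\<close> \<open>0 < e\<close> by auto
      \<comment> \<open>As \<open>b\<close> is now total, the approximate solution agrees with it on
        the whole finite support of \<open>P\<close>.\<close>
      have "P b = P c" using Y'(2) by (rule definable_cong) (use c(1) total in auto)
      then show ?thesis using c(2) by simp
    qed
    then have "P b \<le> 0 + e" if "0 < e" for e :: real
      unfolding add_0 using that .
    then have "P b \<le> 0" by (rule field_le_epsilon)
    then show ?thesis using definable_bounds[OF ok Y'(2), of b] by simp
  qed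
  then show ?thesis by blast
qed

subsection \<open>The Ramsey property yields indiscernibles\<close>

text \<open>In the induction on \<open>T\<close>, the new pair is handled by a Ramsey witness
  \<open>C\<close>, and the induction hypothesis is applied to \<open>C\<close> instead of
  \<open>B\<close>: everything embedded into \<open>C\<close> stays homogeneous for the old pairs,
  so a monochromatic copy inside \<open>C\<close> serves all pairs.\<close>

lemma age_ERP_homogeneous:
  fixes I :: "('i,'f,'r) fstruct" and T :: "(('i list \<Rightarrow> real) \<times> 'i list) set"
  assumes erp: "age_ERP I" and lf: "locally_finite I" and e: "0 < e"
    and "finite T" and "\<forall>(h,js)\<in>T. \<forall>l. h l \<in> {0..1}"
  shows "fin_sub I B \<Longrightarrow> \<exists>g. emb I B UNIV g \<and> (\<forall>(h,js)\<in>T. \<forall>d d'.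
     emb I (gen_sub I (set js)) B d \<longrightarrow> emb I (gen_sub I (set js)) B d' \<longrightarrow>
     \<bar>h (map g (map d js)) - h (map g (map d' js))\<bar> \<le> e)"
  using assms(4,5)
proof (induction T arbitrary: B rule: finite_induct)
  case empty
  then have "emb I B UNIV (\<lambda>x\<in>B. x)"
    by (intro emb_inclusion) (auto simp: fin_sub_def)
  then show ?case by blast
next
  case (insert hj T)
  obtain h js where hj: "hj = (h, js)" by fastforce
  let ?A = "gen_sub I (set js)"
  \<comment> \<open>\<open>B\<close> need not contain \<open>?A\<close>, but the Ramsey property is
    available only for a substructure and a larger one containing it.\<close>
  let ?B = "gen_sub I (B \<union> ?A)"
  have A: "fin_sub I ?A" by (intro fin_sub_gen_sub lf) simp
  then have "finite (B \<union> ?A)" using insert.prems(1) by (auto simp: fin_sub_def)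
  then have B: "fin_sub I ?B" by (intro fin_sub_gen_sub lf)
  have sub: "B \<subseteq> ?B" "?A \<subseteq> ?B" using gen_sub_superset[of "B \<union> ?A" I] by auto
  \<comment> \<open>Dividing values from the unit interval by \<open>e\<close> and rounding down
    leaves the colours 0 to \<open>\<lfloor>1 / e\<rfloor>\<close>.\<close>
  define r where "r = nat \<lfloor>1 / e\<rfloor> + 1"
  obtain C where C: "fin_sub I C" "arrows I C ?B ?A r"
    using erp A B sub(2) unfolding age_ERP_def by blast
  have "\<forall>(h,js)\<in>T. \<forall>l. h l \<in> {0..1}" using insert.prems(2) by blast
  from insert.IH[OF C(1) this] obtain g where g: "emb I C UNIV g" and hom: "\<forall>(h,js)\<in>T. \<forall>d d'.
     emb I (gen_sub I (set js)) C d \<longrightarrow> emb I (gen_sub I (set js)) C d' \<longrightarrow>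
     \<bar>h (map g (map d js)) - h (map g (map d' js))\<bar> \<le> e"
    by (elim exE conjE)
  have h01: "h l \<in> {0..1}" for l using insert.prems(2) hj by auto
  define col where "col d = nat \<lfloor>h (map g (map d js)) / e\<rfloor>" for d
  have "col d < r" for d
  proof -
    have "h (map g (map d js)) / e \<le> 1 / e"
      using h01 e by (intro divide_right_mono) auto
    then have "\<lfloor>h (map g (map d js)) / e\<rfloor> \<le> \<lfloor>1 / e\<rfloor>" by (rule floor_mono)
    then show ?thesis unfolding col_def r_def by linarith
  qed
  then have "col \<in> binom I C ?A \<rightarrow> {..<r}" by auto
  then obtain f c where f: "emb I ?B C f" "\<And>d. emb I ?A ?B d \<Longrightarrow> col (compose ?A f d) = c"
    using C(2) unfolding arrows_def binom_def by blast
  have clB: "closed_sub I B" and clBB: "closed_sub I ?B" using insert.prems(1) B by (auto simp: fin_sub_def)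
  have gf: "emb I B UNIV (restrict (compose ?B g f) B)"
    using emb_restrict[OF emb_compose[OF clBB f(1) g] sub(1) clB] .
  have up: "emb I X ?B d" if "emb I X B d" for X d
    using that sub(1) embD(2)[OF that] by (intro emb_image_mono[OF that]) auto
  have comp: "map (restrict (compose ?B g f) B) (map d ks)
      = map g (map (compose (gen_sub I (set ks)) f d) ks)"
    if "emb I (gen_sub I (set ks)) B d" for ks d
    using gen_sub_superset[of "set ks" I] embD(2)[OF that] sub(1) by (auto simp: compose_def)
  show ?case
  proof (rule exI, intro conjI ballI, rule gf, clarify)
    fix h' ks d d' assume mem: "(h', ks) \<in> insert hj T"
      and d: "emb I (gen_sub I (set ks)) B d" and d': "emb I (gen_sub I (set ks)) B d'"
    let ?d = "compose (gen_sub I (set ks)) f d" and ?d' = "compose (gen_sub I (set ks)) f d'"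
    have fd: "emb I (gen_sub I (set ks)) C ?d" "emb I (gen_sub I (set ks)) C ?d'"
      using emb_compose[OF gen_sub_closed up[OF d] f(1)] emb_compose[OF gen_sub_closed up[OF d'] f(1)] by auto
    have "\<bar>h' (map g (map ?d ks)) - h' (map g (map ?d' ks))\<bar> \<le> e"
    proof (cases "(h', ks) \<in> T")
      case True
      then show ?thesis using bspec[OF hom True] fd by blast
    next
      case False
      then have [simp]: "h' = h" "ks = js" using mem hj by auto
      have "col ?d = col ?d'" using f(2)[OF up] d d' by simp
      moreover have "0 \<le> h l / e" for l using h01[of l] e by simp
      ultimately have "\<lfloor>h (map g (map ?d js)) / e\<rfloor> = \<lfloor>h (map g (map ?d' js)) / e\<rfloor>"
        unfolding col_def by (simp add: eq_nat_nat_iff)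
      then have "\<bar>h (map g (map ?d js)) / e - h (map g (map ?d' js)) / e\<bar> < 1"
        by linarith
      then have "\<bar>h (map g (map ?d js)) - h (map g (map ?d' js))\<bar> / e < 1"
        using e by (simp add: diff_divide_distrib[symmetric] abs_divide)
      then show ?thesis using e by simp
    qed
    then show "\<bar>h' (map (restrict (compose ?B g f) B) (map d ks)) - h' (map (restrict (compose ?B g f) B) (map d' ks))\<bar> \<le> e"
      unfolding comp[OF d] comp[OF d'] .
  qed
qed

lemma definable_feval_map:
  assumes "cwf \<sigma> \<phi>" "cfv \<phi> \<subseteq> {..<length js}"
  shows "definable \<sigma> M UNIV (\<lambda>b. feval M ((!) (map b js)) \<phi>)"
proof (rule definableI[of \<sigma> \<phi> "(!) js"])
  show "feval M ((!) (map b js)) \<phi> = feval M (b \<circ> (!) js) \<phi>" for b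
    using assms(2) by (intro feval_cong) auto
qed (use assms in auto)

text \<open>A realization of \<open>EM\<close> is locally based on \<open>a\<close>, since otherwise a bump formula around the values
  at \<open>js\<close> would vanish along the whole class of \<open>js\<close> in \<open>a\<close>, and hence lie in \<open>EM\<close>.\<close>
theorem age_ERP_imp_CMP:
  fixes I :: "('i,'f,'r) fstruct"
  assumes lf: "locally_finite I" and erp: "age_ERP I"
  shows "CMP I TYPE('g) TYPE('s) TYPE('m)"
  unfolding CMP_def cmp_in_def
proof (intro allI impI, elim conjE)
  fix \<sigma> :: "('g,'s) csig" and M :: "('m,'g,'s) mstruct" and a :: "'i \<Rightarrow> 'm"
  assume ok: "mstruct_ok \<sigma> M" and sat: "csaturated \<sigma> M (UNIV :: 'i set)"
  let ?G = "\<lambda>\<phi> js b. feval M ((!) (map b js)) \<phi>"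
  define EM where "EM = {?G \<phi> js | \<phi> js. cwf \<sigma> \<phi> \<and> cfv \<phi> \<subseteq> {..<length js} \<and>
     (\<forall>ks. qftp_eq I ks js \<longrightarrow> ?G \<phi> ks a = 0)}"
  \<comment> \<open>A truncated difference expresses one inequality; symmetry of
    \<open>qftp_eq\<close> supplies the reverse one.\<close>
  define IN where "IN = {\<lambda>b. max 0 (?G \<phi> ks b - ?G \<phi> js b) | \<phi> ks js.
     cwf \<sigma> \<phi> \<and> cfv \<phi> \<subseteq> {..<length ks} \<and> qftp_eq I ks js}"
  have len: "length ks = length js" if "qftp_eq I ks js" for ks js
    using that unfolding qftp_eq_def by simp
  have "\<exists>b. \<forall>P\<in>EM \<union> IN. P b = 0"
  proof (rule realize_definable[OF ok sat])
    have "definable \<sigma> M UNIV P" if "P \<in> EM" for P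
      using that definable_feval_map unfolding EM_def by blast
    moreover have "definable \<sigma> M UNIV P" if P: "P \<in> IN" for P
    proof -
      obtain \<phi> ks js where *: "P = (\<lambda>b. max 0 (?G \<phi> ks b - ?G \<phi> js b))"
        "cwf \<sigma> \<phi>" "cfv \<phi> \<subseteq> {..<length ks}" "qftp_eq I ks js"
        using P unfolding IN_def by blast
      show ?thesis unfolding *(1)
        using *(2-3) len[OF *(4)] by (intro definable_minus definable_feval_map) auto
    qed
    ultimately show "\<forall>P\<in>EM \<union> IN. definable \<sigma> M UNIV P" by blast
  next
    fix F and e :: real assume F: "finite F" "F \<subseteq> EM \<union> IN" and e: "0 < e"
    let ?hom = "\<lambda>T B g. \<forall>(h,js)\<in>T. \<forall>d d'.
       emb I (gen_sub I (set js)) B d \<longrightarrow> emb I (gen_sub I (set js)) B d' \<longrightarrow>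
       \<bar>h (map g (map d js)) - h (map g (map d' js))\<bar> \<le> e"
    \<comment> \<open>\<open>T\<close> and \<open>X\<close> are finite data to be arranged:
      homogeneity for \<open>T\<close> on a closed \<open>B\<close> containing \<open>X\<close>
      forces \<open>P\<close> below \<open>e\<close> along \<open>a \<circ> g\<close>. Such data can
      be united over the finitely many \<open>P\<close>.\<close>
    define good where "good P T X \<longleftrightarrow> finite T \<and> finite X \<and> (\<forall>(h,js)\<in>T. \<forall>l. h l \<in> {0..1::real}) \<and>
      (\<forall>B g. closed_sub I B \<longrightarrow> X \<subseteq> B \<longrightarrow> emb I B UNIV g \<longrightarrow> ?hom T B g \<longrightarrow> P (a \<circ> g) \<le> e)" for P T X
    have EM: "good P {} (set js)" if "P = ?G \<phi> js" "\<forall>ks. qftp_eq I ks js \<longrightarrow> ?G \<phi> ks a = 0" for P \<phi> js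
      unfolding good_def
    proof (intro conjI allI impI)
      fix B g assume "closed_sub I B" "set js \<subseteq> B" "emb I B UNIV g"
      then have "?G \<phi> (map g js) a = 0" using qftp_eq_emb that(2) by blast
      then show "P (a \<circ> g) \<le> e" using that(1) e by simp
    qed auto
    have IN: "good P {(\<lambda>l. ?G \<phi> l a, js)} (set ks \<union> set js)"
      if P: "P = (\<lambda>b. max 0 (?G \<phi> ks b - ?G \<phi> js b))" and wf: "cwf \<sigma> \<phi>" and q: "qftp_eq I ks js"
      for P \<phi> ks js
      unfolding good_def
    proof (intro conjI allI impI)
      show "\<forall>(h,js')\<in>{(\<lambda>l. ?G \<phi> l a, js)}. \<forall>l. h l \<in> {0..1::real}"
        using feval_bounds[OF ok wf] by simp
      fix B g assume B: "closed_sub I B" "set ks \<union> set js \<subseteq> B" and g: "emb I B UNIV g"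
        and hom: "?hom {(\<lambda>l. ?G \<phi> l a, js)} B g"
      \<comment> \<open>\<open>js\<close> and \<open>ks\<close> are the images of one tuple under
        two embeddings into \<open>B\<close>, the inclusion and \<open>d\<close>; homogeneity
        compares the values there.\<close>
      obtain d where d: "emb I (gen_sub I (set js)) (gen_sub I (set ks)) d" "map d js = ks"
        using emb_of_qftp_eq[OF qftp_eq_sym[OF q]] by blast
      have sub: "gen_sub I (set ks) \<subseteq> B" "gen_sub I (set js) \<subseteq> B"
        using B gen_sub_least[of "set ks" B I] gen_sub_least[of "set js" B I] by auto
      have d': "emb I (gen_sub I (set js)) B d"
        using embD(2)[OF d(1)] sub(1) by (intro emb_image_mono[OF d(1)]) auto
      have i: "emb I (gen_sub I (set js)) B (\<lambda>x\<in>gen_sub I (set js). x)"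
        by (rule emb_inclusion[OF gen_sub_closed sub(2)])
      have js: "map (\<lambda>x\<in>gen_sub I (set js). x) js = js"
        using gen_sub_superset[of "set js" I] by (auto intro!: map_idI)
      have "\<forall>d d'. emb I (gen_sub I (set js)) B d \<longrightarrow> emb I (gen_sub I (set js)) B d' \<longrightarrow>
          \<bar>?G \<phi> (map g (map d js)) a - ?G \<phi> (map g (map d' js)) a\<bar> \<le> e"
        using bspec[OF hom insertI1] by (simp only: prod.case)
      then have "\<bar>?G \<phi> (map g (map d js)) a - ?G \<phi> (map g (map (\<lambda>x\<in>gen_sub I (set js). x) js)) a\<bar> \<le> e"
        using d' i by blast
      then have "\<bar>?G \<phi> (map g ks) a - ?G \<phi> (map g js) a\<bar> \<le> e"
        unfolding d(2) js .
      then show "P (a \<circ> g) \<le> e" using P e by simp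
    qed auto
    have *: "\<forall>P\<in>F. \<exists>TX. good P (fst TX) (snd TX)"
    proof
      fix P assume "P \<in> F"
      then consider "P \<in> EM" | "P \<in> IN" using F by blast
      then show "\<exists>TX. good P (fst TX) (snd TX)"
      proof cases
        case 1
        then obtain \<phi> js where "P = ?G \<phi> js" "\<forall>ks. qftp_eq I ks js \<longrightarrow> ?G \<phi> ks a = 0"
          unfolding EM_def by blast
        from EM[OF this] show ?thesis by (intro exI[of _ "({}, set js)"]) simp
      next
        case 2
        then obtain \<phi> ks js where "P = (\<lambda>b. max 0 (?G \<phi> ks b - ?G \<phi> js b))" "cwf \<sigma> \<phi>" "qftp_eq I ks js"
          unfolding IN_def by blast
        from IN[OF this] show ?thesis
          by (intro exI[of _ "({(\<lambda>l. ?G \<phi> l a, js)}, set ks \<union> set js)"]) simp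
      qed
    qed
    obtain TX where TX: "\<forall>P\<in>F. good P (fst (TX P)) (snd (TX P))"
      using bchoice[OF *] by (rule exE)
    let ?T = "\<Union>P\<in>F. fst (TX P)" and ?B = "gen_sub I (\<Union>P\<in>F. snd (TX P))"
    have T: "finite ?T" "\<forall>(h,js)\<in>?T. \<forall>l. h l \<in> {0..1}" "finite (\<Union>P\<in>F. snd (TX P))"
      using F(1) TX[unfolded good_def] by auto
    obtain g where g: "emb I ?B UNIV g" "?hom ?T ?B g"
      using age_ERP_homogeneous[OF erp lf e T(1,2) fin_sub_gen_sub[OF lf T(3)]] by (elim exE conjE)
    have "P (a \<circ> g) \<le> e" if "P \<in> F" for P
    proof -
      have "snd (TX P) \<subseteq> ?B" using gen_sub_superset[of "\<Union>P\<in>F. snd (TX P)" I] that by blast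
      moreover have "?hom (fst (TX P)) ?B g" using g(2) that by blast
      ultimately show ?thesis
        using bspec[OF TX that, unfolded good_def] g(1) gen_sub_closed[of I] by blast
    qed
    then show "\<exists>c. \<forall>P\<in>F. P c \<le> e" by blast
  qed
  then obtain b where b: "\<And>P. P \<in> EM \<union> IN \<Longrightarrow> P b = 0" by blast
  have "indiscernible I \<sigma> M b"
    unfolding indiscernible_def
  proof (intro allI impI)
    fix ks js \<phi> assume q: "qftp_eq I ks js" and \<phi>: "cwf \<sigma> \<phi> \<and> cfv \<phi> \<subseteq> {..<length ks}"
    have INI: "(\<lambda>b. max 0 (?G \<phi> ks b - ?G \<phi> js b)) \<in> IN"
      if "cfv \<phi> \<subseteq> {..<length ks}" "qftp_eq I ks js" for ks js
      unfolding IN_def using that \<phi> by (intro CollectI exI conjI) (rule refl; assumption | simp)+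
    have "(\<lambda>b. max 0 (?G \<phi> ks b - ?G \<phi> js b)) \<in> IN" "(\<lambda>b. max 0 (?G \<phi> js b - ?G \<phi> ks b)) \<in> IN"
      using INI[of ks js] INI[of js ks] q qftp_eq_sym[OF q] \<phi> len[OF q] by auto
    from this[THEN UnI2[of _ _ EM], THEN b] show "?G \<phi> ks b = ?G \<phi> js b"
      by (simp add: max_def split: if_splits)
  qed
  moreover have "locally_based I \<sigma> M b a"
    unfolding locally_based_def
  proof (intro allI impI, elim conjE, rule ccontr)
    fix \<Delta> js and e :: real
    assume \<Delta>: "finite \<Delta>" "\<forall>\<phi>\<in>\<Delta>. cwf \<sigma> \<phi> \<and> cfv \<phi> \<subseteq> {..<length js}" and e: "0 < e"
      and no: "\<not> (\<exists>ks. qftp_eq I ks js \<and> (\<forall>\<phi>\<in>\<Delta>. \<bar>?G \<phi> js b - ?G \<phi> ks a\<bar> \<le> e))"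
    have "\<forall>\<phi>\<in>\<Delta>. ?G \<phi> js b \<in> {0..1}" using feval_bounds[OF ok] \<Delta>(2) by blast
    from bump_formula[OF ok \<Delta> e this] obtain \<psi> where \<psi>: "cwf \<sigma> \<psi>" "cfv \<psi> \<subseteq> {..<length js}"
      "\<forall>s. (\<exists>\<phi>\<in>\<Delta>. \<bar>?G \<phi> js b - feval M s \<phi>\<bar> > e) \<longrightarrow> feval M s \<psi> = 0"
      "\<forall>s. (\<forall>\<phi>\<in>\<Delta>. feval M s \<phi> = ?G \<phi> js b) \<longrightarrow> feval M s \<psi> > 0"
      by (elim exE conjE)
    have "?G \<psi> ks a = 0" if "qftp_eq I ks js" for ks
      using no that by (intro \<psi>(3)[rule_format]) (auto simp: not_le)
    then have "?G \<psi> js \<in> EM" unfolding EM_def using \<psi>(1,2) by blast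
    then have "?G \<psi> js b = 0" using b[of "?G \<psi> js"] by blast
    then show False using \<psi>(4)[rule_format, of "(!) (map b js)"] by simp
  qed
  ultimately show "\<exists>b. indiscernible I \<sigma> M b \<and> locally_based I \<sigma> M b a" by blast
qed

subsection \<open>A saturated structure with a generic relation\<close>

text \<open>Compactness of a product of finite colour sets. If a maximal \<open>G\<close> gave
  \<open>k\<close> no colour, finite data would refute each of the \<open>r\<close> colours; an
  \<open>x\<close> meeting all these data still gives \<open>k\<close> some colour. This serves both
  to complete partial types and to glue colourings.\<close>

lemma finite_colour_compactness:
  fixes f :: "'x \<Rightarrow> 'k \<Rightarrow> nat"
  assumes r: "\<And>x k. f x k < r"
    and fin: "\<And>Q. finite Q \<Longrightarrow> Q \<subseteq> S \<Longrightarrow> \<exists>x. \<forall>q\<in>Q. sat x q"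
  shows "\<exists>\<pi>. \<forall>Q K. finite Q \<longrightarrow> Q \<subseteq> S \<longrightarrow> finite K \<longrightarrow>
    (\<exists>x. (\<forall>q\<in>Q. sat x q) \<and> (\<forall>k\<in>K. f x k = \<pi> k))"
proof -
  define Good where "Good G \<longleftrightarrow> (\<forall>Q G0. finite Q \<and> Q \<subseteq> S \<and> finite G0 \<and> G0 \<subseteq> G \<longrightarrow>
    (\<exists>x. (\<forall>q\<in>Q. sat x q) \<and> (\<forall>(k,v)\<in>G0. f x k = v)))" for G
  have GoodD: "\<exists>x. (\<forall>q\<in>Q. sat x q) \<and> (\<forall>(k,v)\<in>G0. f x k = v)"
    if "Good G" "finite Q" "Q \<subseteq> S" "finite G0" "G0 \<subseteq> G" for G Q G0
    using that unfolding Good_def by blast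
  have "\<exists>G. Good G \<and> (\<forall>x. Good (insert x G) \<longrightarrow> x \<in> G)"
  proof (rule finite_character_maximal)
    show "Good G" if "\<And>G0. finite G0 \<Longrightarrow> G0 \<subseteq> G \<Longrightarrow> Good G0" for G
      unfolding Good_def
    proof (intro allI impI)
      fix Q G0 assume "finite Q \<and> Q \<subseteq> S \<and> finite G0 \<and> G0 \<subseteq> G"
      then show "\<exists>x. (\<forall>q\<in>Q. sat x q) \<and> (\<forall>(k,v)\<in>G0. f x k = v)"
        using GoodD[OF that[of G0]] by blast
    qed
    show "Good G0" if "Good G" "G0 \<subseteq> G" for G G0
      using that unfolding Good_def by (meson order_trans)
    show "Good {}"
      unfolding Good_def
    proof (intro allI impI)
      fix Q and G0 :: "('k \<times> nat) set" assume "finite Q \<and> Q \<subseteq> S \<and> finite G0 \<and> G0 \<subseteq> {}"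
      then show "\<exists>x. (\<forall>q\<in>Q. sat x q) \<and> (\<forall>(k,v)\<in>G0. f x k = v)"
        using fin[of Q] by auto
    qed
  qed
  then obtain G where G: "Good G" and max: "\<And>x. Good (insert x G) \<Longrightarrow> x \<in> G" by blast
  have "\<exists>v. (k, v) \<in> G" for k
  proof (rule ccontr)
    assume "\<nexists>v. (k, v) \<in> G"
    then have "\<not> Good (insert (k, v) G)" for v using max by blast
    then have "\<forall>v. \<exists>QG. finite (fst QG) \<and> fst QG \<subseteq> S \<and> finite (snd QG) \<and> snd QG \<subseteq> insert (k, v) G \<and>
       \<not> (\<exists>x. (\<forall>q\<in>fst QG. sat x q) \<and> (\<forall>(k,v)\<in>snd QG. f x k = v))"
      unfolding Good_def by fastforce
    from choice[OF this] obtain QG where QG: "\<forall>v. finite (fst (QG v)) \<and> fst (QG v) \<subseteq> S \<and> finite (snd (QG v)) \<and>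
       snd (QG v) \<subseteq> insert (k, v) G \<and> \<not> (\<exists>x. (\<forall>q\<in>fst (QG v). sat x q) \<and> (\<forall>(k,v)\<in>snd (QG v). f x k = v))"
      by (rule exE)
    \<comment> \<open>The pairs at \<open>k\<close> are removed so that \<open>?G0\<close> lies in
      \<open>G\<close>; the one belonging to the colour of \<open>x\<close> at \<open>k\<close>
      holds by itself.\<close>
    let ?Q = "\<Union>v<r. fst (QG v)" and ?G0 = "\<Union>v<r. snd (QG v) - {(k, v)}"
    have fQ: "finite ?Q" "?Q \<subseteq> S" "finite ?G0" "?G0 \<subseteq> G" using QG by auto
    obtain x where x: "\<forall>q\<in>?Q. sat x q" "\<forall>(k,v)\<in>?G0. f x k = v"
      using GoodD[OF G fQ] by (elim exE conjE)
    let ?v = "f x k"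
    have v: "?v \<in> {..<r}" using r by simp
    have "\<forall>q\<in>fst (QG ?v). sat x q" using x(1) v by blast
    moreover have "f x k' = v'" if "(k', v') \<in> snd (QG ?v)" for k' v'
    proof (cases "(k', v') = (k, ?v)")
      case False
      then have "(k', v') \<in> ?G0" using that v by blast
      then show ?thesis using bspec[OF x(2)] by blast
    qed simp
    ultimately show False using QG by blast
  qed
  then have "\<forall>k. \<exists>v. (k, v) \<in> G" by blast
  from choice[OF this] obtain \<pi> where \<pi>: "\<forall>k. (k, \<pi> k) \<in> G" by (rule exE)
  have "\<exists>x. (\<forall>q\<in>Q. sat x q) \<and> (\<forall>k\<in>K. f x k = \<pi> k)" if "finite Q" "Q \<subseteq> S" "finite K" for Q K
    using GoodD[OF G that(1,2), of "(\<lambda>k. (k, \<pi> k)) ` K"] that(3) \<pi> by auto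
  then show ?thesis by blast
qed

lemma infinite_pairing:
  assumes "infinite (UNIV :: 'y set)"
  obtains pr :: "'y \<times> 'y \<Rightarrow> 'y" where "inj pr"
proof -
  from card_of_Times_same_infinite[OF assms] obtain pr :: "'y \<times> 'y \<Rightarrow> 'y" where "bij_betw pr (UNIV \<times> UNIV) UNIV"
    unfolding card_of_ordIso[symmetric] by blast
  then show ?thesis using that by (auto simp: bij_betw_def)
qed

text \<open>Every element of \<open>'y set\<close> is read as a list of parameters \<open>U t\<close>, a table of values \<open>V t\<close> on
  codes of \<open>n\<close>-tuples, and a label \<open>W t\<close> that makes every pair of data occur more than
  \<open>|'y|\<close> many times.\<close>
lemma decoding_exists:
  assumes inf: "infinite (UNIV :: 'y set)"
  shows "\<exists>(U :: 'y set \<Rightarrow> 'y \<Rightarrow> 'y set) (V :: 'y set \<Rightarrow> 'y list \<Rightarrow> nat) (W :: 'y set \<Rightarrow> 'y set).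
    \<forall>u \<tau> w. \<exists>t. U t = u \<and> (\<forall>l. length l = n \<longrightarrow> V t l = \<tau> l) \<and> W t = w"
proof -
  obtain pr :: "'y \<times> 'y \<Rightarrow> 'y" where pr: "inj pr" using infinite_pairing[OF inf] .
  obtain g :: "nat \<Rightarrow> 'y" where g: "inj g" using inf infinite_countable_subset by blast
  \<comment> \<open>Pairing lets one subset of \<open>'y\<close> code a whole family of subsets
    indexed by \<open>'y\<close>.\<close>
  define enc where "enc f = {pr (a, b) | a b. b \<in> f a}" for f :: "'y \<Rightarrow> 'y set"
  define dec where "dec t a = {b. pr (a, b) \<in> t}" for t a
  have [simp]: "dec (enc f) = f" for f
    unfolding enc_def dec_def using pr by (auto simp: fun_eq_iff inj_eq)
  \<comment> \<open>The code is injective only on lists of a fixed length, hence the length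
    condition on \<open>V\<close>.\<close>
  define cl where "cl l = foldr (\<lambda>a b. pr (a, b)) l (g 0)" for l
  have "length l = length l' \<Longrightarrow> cl l = cl l' \<Longrightarrow> l = l'" for l l'
    unfolding cl_def by (induction l l' rule: list_induct2) (auto simp: inj_eq[OF pr])
  then have cl: "inj_on cl {l. length l = n}" by (auto intro!: inj_onI)
  have g2: "inj (\<lambda>k. {g k})" using g by (auto simp: inj_def)
  have [simp]: "g (Suc 0) \<noteq> g 0" "g 2 \<noteq> g 0" "g 2 \<noteq> g (Suc 0)" using g by (auto simp: inj_eq)
  show ?thesis
  proof (intro exI allI)
    fix u :: "'y \<Rightarrow> 'y set" and \<tau> :: "'y list \<Rightarrow> nat" and w :: "'y set"
    \<comment> \<open>Table values are stored as singletons. The slots \<open>g 0\<close>,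
      \<open>g 1\<close> and \<open>g 2\<close> hold parameters, table and label.\<close>
    let ?f = "\<lambda>a. {g (\<tau> (inv_into {l. length l = n} cl a))}"
    let ?t = "enc (\<lambda>a. if a = g 0 then enc u else if a = g 1 then enc ?f else w)"
    show "dec (dec ?t (g 0)) = u \<and>
      (\<forall>l. length l = n \<longrightarrow> (inv (\<lambda>k. {g k}) (dec (dec ?t (g 1)) (cl l))) = \<tau> l) \<and> dec ?t (g 2) = w"
      using inv_into_f_f[OF cl] inv_f_f[OF g2] by simp
  qed
qed

text \<open>The extension property of the random graph, for a relation on \<open>n\<close>-tuples
  with \<open>r\<close> values and over parameter families indexed by \<open>'y\<close>. In a
  pattern, \<open>None\<close> marks the places of the new element.\<close>

definition generic_relation :: "nat \<Rightarrow> nat \<Rightarrow> ('y set list \<Rightarrow> nat) \<Rightarrow> bool" where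
  "generic_relation n r P \<longleftrightarrow> (\<forall>xs. P xs < r) \<and>
    (\<forall>(u :: 'y \<Rightarrow> 'y set) \<tau>. (\<forall>l. \<tau> l < r) \<longrightarrow> (\<exists>m. m \<notin> range u \<and>
       (\<forall>xs. length xs = n \<longrightarrow> m \<in> set xs \<longrightarrow> set xs \<subseteq> insert m (range u) \<longrightarrow>
          P xs = \<tau> (map (\<lambda>z. if z = m then None else Some z) xs))))"

text \<open>A tuple is valued by an entry that has all other entries among its parameters. The fresh
  element is chosen outside the parameters of its own parameters, so that no other entry
  competes with it.\<close>
lemma generic_relation_exists:
  fixes d :: "'y \<Rightarrow> 'y set"
  assumes inf: "infinite (UNIV :: 'y set)" and c: "\<And>xs. c xs < r"
  shows "\<exists>P. generic_relation n r P \<and> (\<forall>xs. set xs \<subseteq> range d \<longrightarrow> P xs = c xs)"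
proof -
  obtain U :: "'y set \<Rightarrow> 'y \<Rightarrow> 'y set" and V :: "'y set \<Rightarrow> 'y list \<Rightarrow> nat" and W :: "'y set \<Rightarrow> 'y set"
    where UVW: "\<forall>u \<tau> w. \<exists>t. U t = u \<and> (\<forall>l. length l = n \<longrightarrow> V t l = \<tau> l) \<and> W t = w"
    using decoding_exists[OF inf, of n] by (elim exE)
  obtain pr :: "'y \<times> 'y \<Rightarrow> 'y" where pr: "inj pr" using infinite_pairing[OF inf] .
  obtain g :: "nat \<Rightarrow> 'y" where g: "inj g" using inf infinite_countable_subset by blast
  have [simp]: "g (Suc 0) \<noteq> g 0" "g 2 \<noteq> g 0" "g 2 \<noteq> g (Suc 0)" using g by (auto simp: inj_eq)
  define y0 where "y0 = g 0"
  \<comment> \<open>\<open>y0\<close> is reserved as the code of the valuing element itself;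
    \<open>h\<close> moves a full family of parameters to the remaining indices.\<close>
  obtain h :: "'y \<Rightarrow> 'y" where h: "bij_betw h UNIV (UNIV - {y0})"
    using infinite_imp_bij_betw[OF inf, of y0] by blast
  have r0: "0 < r" using c[of "[]"] by simp
  define cand where "cand m xs \<longleftrightarrow> m \<in> set xs \<and> (\<forall>z\<in>set xs. z = m \<or> z \<in> U m ` (UNIV - {y0}))" for m xs
  define code where "code m z = (if z = m then y0 else SOME y. y \<noteq> y0 \<and> U m y = z)" for m z
  \<comment> \<open>Tuples from \<open>range d\<close> carry the prescribed colouring, so a new
    element must also avoid \<open>range d\<close>. The remainder modulo \<open>r\<close> tames
    arbitrary tables.\<close>
  define P where "P xs = (if set xs \<subseteq> range d then c xs
    else V (SOME m. cand m xs) (map (code (SOME m. cand m xs)) xs) mod r)" for xs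
  have "generic_relation n r P"
    unfolding generic_relation_def
  proof (intro conjI allI impI)
    show "P xs < r" for xs unfolding P_def using c r0 by simp
  next
    fix u :: "'y \<Rightarrow> 'y set" and \<tau> :: "'y set option list \<Rightarrow> nat"
    assume \<tau>: "\<forall>l. \<tau> l < r"
    define u' where "u' = u \<circ> inv_into UNIV h"
    have u': "u' ` (UNIV - {y0}) = range u"
    proof -
      have "inv_into UNIV h ` (UNIV - {y0}) = UNIV"
        using h by (metis bij_betw_def inv_into_image_cancel order_refl)
      then show ?thesis unfolding u'_def by (metis image_comp)
    qed
    define \<tau>' where "\<tau>' l = \<tau> (map (\<lambda>y. if y = y0 then None else Some (u' y)) l)" for l
    \<comment> \<open>Everything the new element must avoid: parameters, the range of
      \<open>d\<close>, and parameters of parameters, coded as one family indexed by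
      \<open>'y\<close>.\<close>
    define B where "B k a b = (if k = g 0 then u a else if k = g 1 then d a else U (u a) b)" for k a b
    define B' where "B' y = (case inv pr y of (k, y') \<Rightarrow> case inv pr y' of (a, b) \<Rightarrow> B k a b)" for y
    have B': "B' (pr (k, pr (a, b))) = B k a b" for k a b
      unfolding B'_def by (simp add: inv_f_f[OF pr])
    \<comment> \<open>Cantor's diagonal set: it is the label of no listed element, so any element
      with this label is new.\<close>
    define w where "w = {y. y \<notin> W (B' y)}"
    obtain m where m: "U m = u'" "\<forall>l. length l = n \<longrightarrow> V m l = \<tau>' l" "W m = w"
      using UVW by blast
    have "m \<noteq> B' y" for y
    proof
      assume "m = B' y"
      then have "W (B' y) = w" using m(3) by simp
      then show False unfolding w_def by blast
    qed
    then have "m \<noteq> B k a b" for k a b using B'[of k a b] by metis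
    from this[of "g 0"] this[of "g 1"] this[of "g 2"]
    have new: "m \<noteq> u a" "m \<noteq> d a" "m \<noteq> U (u a) b" for a b unfolding B_def by auto
    show "\<exists>m. m \<notin> range u \<and>
       (\<forall>xs. length xs = n \<longrightarrow> m \<in> set xs \<longrightarrow> set xs \<subseteq> insert m (range u) \<longrightarrow>
          P xs = \<tau> (map (\<lambda>z. if z = m then None else Some z) xs))"
    proof (intro exI[of _ m] conjI allI impI)
      show "m \<notin> range u" using new by auto
      fix xs assume xs: "length xs = n" "m \<in> set xs" "set xs \<subseteq> insert m (range u)"
      have nd: "\<not> set xs \<subseteq> range d" using xs(2) new(2) by auto
      have "cand m xs" unfolding cand_def m(1) u' using xs by auto
      moreover have "m' = m" if cand: "cand m' xs" for m'
      proof (rule ccontr)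
        assume ne: "m' \<noteq> m"
        have "m' \<in> set xs" using cand unfolding cand_def by simp
        then have "m' \<in> range u" using ne xs(3) by blast
        then obtain a where "m' = u a" by blast
        moreover have "m \<in> range (U m')" using cand ne xs(2) unfolding cand_def by blast
        ultimately show False using new(3) by auto
      qed
      ultimately have some: "(SOME m. cand m xs) = m" by (rule some_equality)
      have "P xs = V m (map (code m) xs) mod r"
        unfolding P_def using nd by (simp add: some)
      also have "V m (map (code m) xs) = \<tau>' (map (code m) xs)" using m(2) xs(1) by simp
      also have "\<tau>' (map (code m) xs) = \<tau> (map (\<lambda>z. if z = m then None else Some z) xs)"
      proof -
        have eq: "(if code m z = y0 then None else Some (u' (code m z))) = (if z = m then None else Some z)"
          if "z \<in> set xs" for z
        proof (cases "z = m")
          case False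
          then have "z \<in> u' ` (UNIV - {y0})" unfolding u' using that xs(3) by blast
          then have "\<exists>y. y \<noteq> y0 \<and> u' y = z" by blast
          from someI_ex[OF this] show ?thesis using False unfolding code_def m(1) by simp
        qed (simp add: code_def)
        show ?thesis
          unfolding \<tau>'_def map_map o_def by (rule arg_cong[where f = \<tau>], rule map_cong[OF refl], rule eq)
      qed
      finally show "P xs = \<tau> (map (\<lambda>z. if z = m then None else Some z) xs)"
        using \<tau> by simp
    qed
  qed
  moreover have "\<forall>xs. set xs \<subseteq> range d \<longrightarrow> P xs = c xs" unfolding P_def by simp
  ultimately show ?thesis by blast
qed

section \<open>The generic relation as a discrete continuous structure\<close>

text \<open>All function symbols are interpreted as the identity and all relation symbols alike, so
  that symbols play no role.\<close>
definition discrete_sig :: "nat \<Rightarrow> ('g,'s) csig" where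
  "discrete_sig n = \<lparr>fa = \<lambda>_. 1, ra = \<lambda>_. n, fmod = \<lambda>_ _. 1, rmod = \<lambda>_ _. 1\<rparr>"

definition discrete_struct :: "nat \<Rightarrow> ('m list \<Rightarrow> nat) \<Rightarrow> ('m,'g,'s) mstruct" where
  "discrete_struct r P = \<lparr>md = \<lambda>x y. if x = y then 0 else 1, mfn = \<lambda>_ xs. hd xs,
     mrel = \<lambda>_ xs. real (P xs) / real r\<rparr>"

lemma discrete_sig_simps [simp]:
  "fa (discrete_sig n) F = 1" "ra (discrete_sig n) R = n" "fmod (discrete_sig n) F e = 1"
  "rmod (discrete_sig n) R e = 1"
  unfolding discrete_sig_def by simp_all

lemma discrete_struct_simps [simp]:
  "md (discrete_struct r P) x y = (if x = y then 0 else 1)" "mfn (discrete_struct r P) F xs = hd xs"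
  "mrel (discrete_struct r P) R xs = real (P xs) / real r"
  unfolding discrete_struct_def by simp_all

text \<open>Distance below 1 means equality. Hence Cauchy sequences are eventually constant, and the
  constant modulus 1 works for all symbols.\<close>

lemma mstruct_ok_discrete:
  assumes P: "\<And>xs. P xs < r"
  shows "mstruct_ok (discrete_sig n) (discrete_struct r P)"
proof -
  have r0: "0 < r" using P[of "[]"] by simp
  have complete: "\<exists>l. (\<lambda>k. if X k = l then 0 else 1 :: real) \<longlonglongrightarrow> 0"
    if Cauchy: "\<forall>e>0. \<exists>N. \<forall>m\<ge>N. \<forall>n\<ge>N. (if X m = X n then 0 else 1 :: real) < e" for X :: "nat \<Rightarrow> 'a"
  proof -
    obtain N where N: "\<forall>m\<ge>N. \<forall>n\<ge>N. (if X m = X n then 0 else 1 :: real) < 1"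
      using Cauchy[THEN spec, THEN mp, OF zero_less_one] by (rule exE)
    have eq: "X k = X N" if "k \<ge> N" for k
    proof (rule ccontr)
      assume "X k \<noteq> X N"
      moreover have "(if X k = X N then 0 else 1 :: real) < 1" by (rule N[rule_format, OF that order_refl])
      ultimately show False by simp
    qed
    have "eventually (\<lambda>k. (if X k = X N then 0 else 1 :: real) = 0) sequentially"
      unfolding eventually_sequentially by (intro exI[of _ N] allI impI if_P eq)
    then show ?thesis by (intro exI[of _ "X N"] tendsto_eventually)
  qed
  have nth: "xs = ys" if "length xs = k" "length ys = k" "\<forall>j<k. (if xs ! j = ys ! j then 0 else 1 :: real) < 1"
    for xs ys :: "'a list" and k
    using that by (intro nth_equalityI) (auto split: if_splits)
  have le1: "real (P xs) / real r \<le> 1" for xs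
    using P[of xs] r0 by (simp add: field_simps)
  show ?thesis
    unfolding mstruct_ok_def discrete_struct_simps discrete_sig_simps
  proof (intro conjI allI impI)
    fix X :: "nat \<Rightarrow> 'a"
    assume "\<forall>e>0. \<exists>N. \<forall>m\<ge>N. \<forall>n\<ge>N. (if X m = X n then 0 else 1 :: real) < e"
    then show "\<exists>l. (\<lambda>n. if X n = l then 0 else 1 :: real) \<longlonglongrightarrow> 0" by (rule complete)
  next
    fix xs ys :: "'a list" and e :: real
    assume "0 < e" and A: "length xs = 1" "length ys = 1" "\<forall>k<1. (if xs ! k = ys ! k then 0 else 1 :: real) < 1"
    show "(if hd xs = hd ys then 0 else 1) \<le> e" using nth[OF A] \<open>0 < e\<close> by simp
  next
    fix xs ys :: "'a list" and e :: real
    assume "0 < e" and A: "length xs = n" "length ys = n" "\<forall>k<n. (if xs ! k = ys ! k then 0 else 1 :: real) < 1"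
    show "\<bar>real (P xs) / real r - real (P ys) / real r\<bar> \<le> e" using nth[OF A] \<open>0 < e\<close> by simp
  qed (use le1 in auto)
qed

lemma tev_discrete:
  assumes "wft (fa (discrete_sig n)) t"
  shows "\<exists>v. v \<in> fvt t \<and> (\<forall>s. tev (mfn (discrete_struct r P)) s t = s v)"
  using assms
proof (induction t)
  case (Fn f ts)
  then obtain t where ts: "ts = [t]" by (auto simp: length_Suc_conv)
  then show ?case using Fn by simp
qed simp

text \<open>Says that sending \<open>s x\<close> to \<open>s' x\<close> for \<open>x\<close> in
  \<open>V\<close> is a partial isomorphism; the equality pattern makes it a well-defined
  injection.\<close>

definition same_qf :: "nat \<Rightarrow> ('m list \<Rightarrow> nat) \<Rightarrow> nat set \<Rightarrow> (nat \<Rightarrow> 'm) \<Rightarrow> (nat \<Rightarrow> 'm) \<Rightarrow> bool" where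
  "same_qf n P V s s' \<longleftrightarrow> (\<forall>x\<in>V. \<forall>y\<in>V. s x = s y \<longleftrightarrow> s' x = s' y) \<and>
     (\<forall>xs. length xs = n \<longrightarrow> set xs \<subseteq> V \<longrightarrow> P (map s xs) = P (map s' xs))"

lemma same_qf_sym: "same_qf n P V s s' \<Longrightarrow> same_qf n P V s' s"
  unfolding same_qf_def by auto

lemma same_qf_mono:
  assumes "same_qf n P V s s'" "V' \<subseteq> V"
  shows "same_qf n P V' s s'"
  unfolding same_qf_def
proof (intro conjI ballI allI impI)
  show "s x = s y \<longleftrightarrow> s' x = s' y" if "x \<in> V'" "y \<in> V'" for x y
    using assms that unfolding same_qf_def by blast
  show "P (map s xs) = P (map s' xs)" if "length xs = n" "set xs \<subseteq> V'" for xs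
    using assms(1) that(1) order_trans[OF that(2) assms(2)] unfolding same_qf_def by blast
qed

lemma subset_range_of_inj:
  fixes g :: "'a \<Rightarrow> 'y"
  shows "inj_on g A \<Longrightarrow> \<exists>u :: 'y \<Rightarrow> 'a. A \<subseteq> range u"
proof (intro exI[of _ "inv_into A g"] subsetI)
  fix a assume "inj_on g A" "a \<in> A"
  then show "a \<in> range (inv_into A g)" by (metis inv_into_f_f rangeI)
qed

lemma finite_subset_range:
  assumes inf: "infinite (UNIV :: 'y set)" and "finite A"
  shows "\<exists>u :: 'y \<Rightarrow> 'a. A \<subseteq> range u"
proof -
  obtain g :: "nat \<Rightarrow> 'y" where g: "inj g" using inf infinite_countable_subset by blast
  obtain f :: "'a \<Rightarrow> nat" where "inj_on f A" using finite_imp_inj_to_nat_seg[OF assms(2)] by blast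
  then have "inj_on (g \<circ> f) A" using g by (auto simp: inj_on_def)
  then show ?thesis by (rule subset_range_of_inj)
qed

text \<open>The extension step of back-and-forth: a repeated value is copied, a new one is imitated
  by a generic element.\<close>

lemma same_qf_extend:
  fixes P :: "'y set list \<Rightarrow> nat"
  assumes inf: "infinite (UNIV :: 'y set)" and gen: "generic_relation n r P" and fin: "finite V"
    and same: "same_qf n P (V - {x}) s s'"
  shows "\<exists>m'. same_qf n P V (s(x := m)) (s'(x := m'))"
proof (cases "\<exists>y\<in>V - {x}. s y = m")
  case True
  then obtain y where y: "y \<in> V - {x}" "s y = m" by blast
  define q where "q v = (if v = x then y else v)" for v
  have q: "s(x := m) = s \<circ> q" "s'(x := s' y) = s' \<circ> q" using y by (auto simp: q_def fun_eq_iff)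
  have qV: "q v \<in> V - {x}" if "v \<in> V" for v using that y unfolding q_def by auto
  have "same_qf n P V (s \<circ> q) (s' \<circ> q)"
    unfolding same_qf_def
  proof (intro conjI allI impI ballI)
    show "(s \<circ> q) v = (s \<circ> q) w \<longleftrightarrow> (s' \<circ> q) v = (s' \<circ> q) w" if "v \<in> V" "w \<in> V" for v w
      using same qV that unfolding same_qf_def by simp
    fix xs assume "length xs = n" "set xs \<subseteq> V"
    then have "length (map q xs) = n" "set (map q xs) \<subseteq> V - {x}" using qV by auto
    then have "P (map s (map q xs)) = P (map s' (map q xs))"
      using same unfolding same_qf_def by blast
    then show "P (map (s \<circ> q) xs) = P (map (s' \<circ> q) xs)" by simp
  qed
  then show ?thesis unfolding q[symmetric] by blast
next
  case False
  let ?A = "s' ` (V - {x})"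
  obtain u :: "'y \<Rightarrow> 'y set" where u: "?A \<subseteq> range u"
    using finite_subset_range[OF inf, of ?A] fin by auto
  \<comment> \<open>Translates patterns over the values of \<open>s'\<close> back to
    \<open>s\<close>, with \<open>m\<close> for the new element. Prescribing \<open>P\<close> of the
    translation makes the generic element behave over \<open>s'\<close> as \<open>m\<close> does
    over \<open>s\<close>.\<close>
  define dc where "dc o' = (case o' of None \<Rightarrow> m | Some z \<Rightarrow> s (inv_into (V - {x}) s' z))" for o'
  have dc: "dc (Some (s' v)) = s v" if "v \<in> V - {x}" for v
  proof -
    have "s' v \<in> ?A" using that by (rule imageI)
    from f_inv_into_f[OF this] inv_into_into[OF this] show ?thesis using same that unfolding same_qf_def dc_def by simp
  qed
  have "\<forall>l. P (map dc l) < r" using gen unfolding generic_relation_def by blast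
  then obtain m' where m': "m' \<notin> range u"
    "\<forall>xs. length xs = n \<longrightarrow> m' \<in> set xs \<longrightarrow> set xs \<subseteq> insert m' (range u) \<longrightarrow>
          P xs = P (map dc (map (\<lambda>z. if z = m' then None else Some z) xs))"
    using conjunct2[OF gen[unfolded generic_relation_def], rule_format, of "\<lambda>l. P (map dc l)" u] by blast
  have new: "s' v \<noteq> m'" "s v \<noteq> m" if "v \<in> V" "v \<noteq> x" for v
    using m'(1) u that False by auto
  have "same_qf n P V (s(x := m)) (s'(x := m'))"
    unfolding same_qf_def
  proof (intro conjI allI impI ballI)
    show "(s(x := m)) v = (s(x := m)) w \<longleftrightarrow> (s'(x := m')) v = (s'(x := m')) w" if "v \<in> V" "w \<in> V" for v w
      using same that new[of v] new[of w] unfolding same_qf_def by auto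
    fix xs assume xs: "length xs = n" "set xs \<subseteq> V"
    show "P (map (s(x := m)) xs) = P (map (s'(x := m')) xs)"
    proof (cases "x \<in> set xs")
      case True
      let ?ys = "map (s'(x := m')) xs"
      have "m' \<in> set ?ys" using True by force
      moreover have "set ?ys \<subseteq> insert m' (range u)" using xs(2) u by auto
      moreover have "length ?ys = n" using xs(1) by simp
      ultimately have "P ?ys = P (map dc (map (\<lambda>z. if z = m' then None else Some z) ?ys))"
        using m'(2) by blast
      moreover have "map dc (map (\<lambda>z. if z = m' then None else Some z) ?ys) = map (s(x := m)) xs"
      proof -
        have "dc (if (s'(x := m')) v = m' then None else Some ((s'(x := m')) v)) = (s(x := m)) v"
          if "v \<in> set xs" for v
          using that new(1)[of v] dc[of v] xs(2) by (auto simp: dc_def)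
        then show ?thesis by simp
      qed
      ultimately show ?thesis by (simp only:)
    next
      case False
      then have "set xs \<subseteq> V - {x}" using xs(2) by blast
      then have "P (map s xs) = P (map s' xs)" using same xs(1) unfolding same_qf_def by blast
      moreover have "map (s(x := m)) xs = map s xs" "map (s'(x := m')) xs = map s' xs"
        using False by auto
      ultimately show ?thesis by (simp only:)
    qed
  qed
  then show ?thesis by blast
qed

lemma feval_same_qf:
  fixes P :: "'y set list \<Rightarrow> nat"
  assumes inf: "infinite (UNIV :: 'y set)" and gen: "generic_relation n r P"
  shows "cwf (discrete_sig n) \<phi> \<Longrightarrow> same_qf n P (cfv \<phi>) s s' \<Longrightarrow>
    feval (discrete_struct r P) s \<phi> = feval (discrete_struct r P) s' \<phi>"
proof (induction \<phi> arbitrary: s s')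
  case (CRel R ts)
  let ?tev = "tev (mfn (discrete_struct r P :: ('y set,'a,'b) mstruct))"
  have "\<forall>t\<in>set ts. \<exists>v. v \<in> fvt t \<and> (\<forall>s. ?tev s t = s v)"
  proof
    fix t assume "t \<in> set ts"
    then have "wft (fa (discrete_sig n :: ('a,'b) csig)) t"
      using CRel.prems(1) by (auto simp: list_all_iff)
    then show "\<exists>v. v \<in> fvt t \<and> (\<forall>s. ?tev s t = s v)" by (rule tev_discrete)
  qed
  from bchoice[OF this] obtain v where v: "\<forall>t\<in>set ts. v t \<in> fvt t \<and> (\<forall>s. ?tev s t = s (v t))"
    by (rule exE)
  then have m: "map (?tev s) ts = map s (map v ts)" for s by simp
  have "length (map v ts) = n" "set (map v ts) \<subseteq> cfv (CRel R ts)"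
    using CRel.prems(1) v by auto
  then have "P (map s (map v ts)) = P (map s' (map v ts))"
    using CRel.prems(2) unfolding same_qf_def by blast
  then show ?case by (simp only: feval.simps m discrete_struct_simps)
next
  case (CDist t u)
  let ?tev = "tev (mfn (discrete_struct r P :: ('y set,'a,'b) mstruct))"
  have wf: "wft (fa (discrete_sig n :: ('a,'b) csig)) t" "wft (fa (discrete_sig n :: ('a,'b) csig)) u"
    using CDist.prems(1) by auto
  obtain v where v: "v \<in> fvt t \<and> (\<forall>s. ?tev s t = s v)" using tev_discrete[OF wf(1)] by (rule exE)
  obtain w where w: "w \<in> fvt u \<and> (\<forall>s. ?tev s u = s w)" using tev_discrete[OF wf(2)] by (rule exE)
  have "v \<in> cfv (CDist t u)" "w \<in> cfv (CDist t u)" using v w by simp_all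
  then have "s v = s w \<longleftrightarrow> s' v = s' w"
    by (rule CDist.prems(2)[unfolded same_qf_def, THEN conjunct1, THEN bspec, THEN bspec])
  then show ?case using v w by simp
next
  case (CNeg \<phi>)
  have "feval (discrete_struct r P) s \<phi> = feval (discrete_struct r P) s' \<phi>"
    using CNeg.prems by (intro CNeg.IH) auto
  then show ?case by simp
next
  case (CHalf \<phi>)
  have "feval (discrete_struct r P) s \<phi> = feval (discrete_struct r P) s' \<phi>"
    using CHalf.prems by (intro CHalf.IH) auto
  then show ?case by simp
next
  case (CMinus \<phi> \<psi>)
  have "feval (discrete_struct r P) s \<phi> = feval (discrete_struct r P) s' \<phi>"
    using CMinus.prems by (intro CMinus.IH(1) same_qf_mono[OF CMinus.prems(2)]) auto
  moreover have "feval (discrete_struct r P) s \<psi> = feval (discrete_struct r P) s' \<psi>"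
    using CMinus.prems by (intro CMinus.IH(2) same_qf_mono[OF CMinus.prems(2)]) auto
  ultimately show ?case by simp
next
  case (CSup x \<phi>)
  \<comment> \<open>Extension in both directions makes the two ranges equal, hence also their
    suprema.\<close>
  have "range (\<lambda>m. feval (discrete_struct r P) (s(x := m)) \<phi>) \<subseteq>
      range (\<lambda>m. feval (discrete_struct r P) (s'(x := m)) \<phi>)"
    if "same_qf n P (cfv \<phi> - {x}) s s'" for s s'
    using same_qf_extend[OF inf gen finite_cfv that] CSup.IH CSup.prems(1)
    by (metis (no_types, lifting) cwf.simps(7) image_subset_iff rangeI)
  then show ?case
    using CSup.prems(2) same_qf_sym[OF CSup.prems(2)] by (metis cfv.simps(7) feval.simps(7) subset_antisym)
next
  case (CInf x \<phi>)
  have "range (\<lambda>m. feval (discrete_struct r P) (s(x := m)) \<phi>) \<subseteq>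
      range (\<lambda>m. feval (discrete_struct r P) (s'(x := m)) \<phi>)"
    if "same_qf n P (cfv \<phi> - {x}) s s'" for s s'
    using same_qf_extend[OF inf gen finite_cfv that] CInf.IH CInf.prems(1)
    by (metis (no_types, lifting) cwf.simps(8) image_subset_iff rangeI)
  then show ?case
    using CInf.prems(2) same_qf_sym[OF CInf.prems(2)] by (metis cfv.simps(8) feval.simps(8) subset_antisym)
qed simp

text \<open>A finitely satisfiable type need not decide how a realization relates to the parameters.
  Compactness fixes these relations as \<open>\<pi>\<close>. Either they name a parameter, which is
  then a realization, or genericity provides a new element with these relations, and quantifier
  elimination transfers the conditions to it.\<close>

lemma csaturated_generic:
  fixes P :: "'y set list \<Rightarrow> nat" and h :: "'k \<Rightarrow> 'y"
  assumes inf: "infinite (UNIV :: 'y set)" and gen: "generic_relation n r P" and h: "inj h"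
  shows "csaturated (discrete_sig n :: ('g,'s) csig) (discrete_struct r P) (UNIV :: 'k set)"
  unfolding csaturated_def
proof (intro allI impI)
  fix A :: "'y set set" and p :: "(('g,'s) cfml \<times> (nat \<Rightarrow> 'y set)) set"
  let ?M = "discrete_struct r P :: ('y set,'g,'s) mstruct" and ?\<sigma> = "discrete_sig n :: ('g,'s) csig"
  assume "\<exists>g :: 'y set \<Rightarrow> 'k. inj_on g A \<and> g ` A \<subseteq> UNIV"
    and wf: "\<forall>(\<phi>, s) \<in> p. cwf ?\<sigma> \<phi> \<and> (\<forall>v \<in> cfv \<phi> - {0}. s v \<in> A)"
    and sat: "\<forall>p0 \<subseteq> p. finite p0 \<longrightarrow> (\<forall>e>0. \<exists>m. \<forall>(\<phi>, s) \<in> p0. feval ?M (s(0 := m)) \<phi> \<le> e)"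
  then obtain g :: "'y set \<Rightarrow> 'k" where "inj_on g A" by blast
  then have "inj_on (h \<circ> g) A" using h by (auto simp: inj_on_def)
  from subset_range_of_inj[OF this] obtain u :: "'y \<Rightarrow> 'y set" where u: "A \<subseteq> range u" by (rule exE)
  have Pr: "P xs < r" for xs using gen unfolding generic_relation_def by blast
  have ok: "mstruct_ok ?\<sigma> ?M" using Pr by (rule mstruct_ok_discrete)
  \<comment> \<open>\<open>Inl l\<close> asks for the value of \<open>P\<close> on a pattern,
    \<open>Inr z\<close> whether \<open>m\<close> is \<open>z\<close>; the bound
    \<open>r + 2\<close> covers both kinds of answer.\<close>
  define f :: "'y set \<Rightarrow> 'y set option list + 'y set \<Rightarrow> nat" where
    "f m k = (case k of Inl l \<Rightarrow> P (map (case_option m (\<lambda>z. z)) l) | Inr z \<Rightarrow> of_bool (m = z))" for m k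
  have "\<exists>\<pi>. \<forall>Q K. finite Q \<longrightarrow> Q \<subseteq> p \<times> {0<..} \<longrightarrow> finite K \<longrightarrow>
    (\<exists>m. (\<forall>q\<in>Q. feval ?M ((snd (fst q))(0 := m)) (fst (fst q)) \<le> snd q) \<and> (\<forall>k\<in>K. f m k = \<pi> k))"
  proof (rule finite_colour_compactness)
    show "f m k < r + 2" for m k
      unfolding f_def using Pr by (auto split: sum.split intro!: less_SucI)
    fix Q :: "((('g,'s) cfml \<times> (nat \<Rightarrow> 'y set)) \<times> real) set" assume Q: "finite Q" "Q \<subseteq> p \<times> {0<..}"
    define e where "e = Min (insert 1 (snd ` Q))"
    have "e > 0" unfolding e_def using Q by auto
    moreover have "fst ` Q \<subseteq> p" "finite (fst ` Q)" using Q by auto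
    ultimately obtain m where m: "\<forall>(\<phi>, s) \<in> fst ` Q. feval ?M (s(0 := m)) \<phi> \<le> e"
      using sat by blast
    have "feval ?M ((snd (fst q))(0 := m)) (fst (fst q)) \<le> snd q" if "q \<in> Q" for q
    proof -
      have "e \<le> snd q" unfolding e_def using Q(1) that by auto
      moreover have "feval ?M ((snd (fst q))(0 := m)) (fst (fst q)) \<le> e"
        using bspec[OF m imageI[OF that]] by (simp add: case_prod_beta)
      ultimately show ?thesis by simp
    qed
    then show "\<exists>m. \<forall>q\<in>Q. feval ?M ((snd (fst q))(0 := m)) (fst (fst q)) \<le> snd q" by blast
  qed
  then obtain \<pi> where \<pi>0: "\<forall>Q K. finite Q \<longrightarrow> Q \<subseteq> p \<times> {0<..} \<longrightarrow> finite K \<longrightarrow>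
    (\<exists>m. (\<forall>q\<in>Q. feval ?M ((snd (fst q))(0 := m)) (fst (fst q)) \<le> snd q) \<and> (\<forall>k\<in>K. f m k = \<pi> k))"
    by (rule exE)
  have \<pi>: "\<exists>m. feval ?M (s(0 := m)) \<phi> \<le> e \<and> (\<forall>k\<in>K. f m k = \<pi> k)"
    if "(\<phi>, s) \<in> p" "0 < e" "finite K" for \<phi> s K and e :: real
    using \<pi>0[THEN spec[of _ "{((\<phi>, s), e)}"], THEN spec[of _ K]] that by auto
  have zero: "\<exists>m. \<forall>(\<phi>, s) \<in> p. feval ?M (s(0 := m)) \<phi> = 0"
    if le: "\<And>\<phi> s e. (\<phi>, s) \<in> p \<Longrightarrow> 0 < e \<Longrightarrow> feval ?M (s(0 := m)) \<phi> \<le> e" for m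
  proof (intro exI[of _ m] ballI, clarify)
    fix \<phi> s assume mem: "(\<phi>, s) \<in> p"
    have "feval ?M (s(0 := m)) \<phi> \<le> 0 + e" if "0 < e" for e
      unfolding add_0 using mem that by (rule le)
    then have "feval ?M (s(0 := m)) \<phi> \<le> 0" by (rule field_le_epsilon)
    moreover have "cwf ?\<sigma> \<phi>" using wf mem by blast
    ultimately show "feval ?M (s(0 := m)) \<phi> = 0"
      using feval_bounds[OF ok, of \<phi> "s(0 := m)"] by simp
  qed
  show "\<exists>m. \<forall>(\<phi>, s) \<in> p. feval ?M (s(0 := m)) \<phi> = 0"
  proof (cases "\<exists>z\<in>A. \<pi> (Inr z) = 1")
    case True
    then obtain z where z: "\<pi> (Inr z) = 1" by blast
    show ?thesis
    proof (rule zero)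
      fix \<phi> s and e :: real assume "(\<phi>, s) \<in> p" "0 < e"
      then obtain m where "feval ?M (s(0 := m)) \<phi> \<le> e" "f m (Inr z) = 1"
        using \<pi>[of \<phi> s e "{Inr z}"] z by auto
      moreover from this(2) have "m = z" by (cases "m = z") (simp_all add: f_def)
      ultimately show "feval ?M (s(0 := z)) \<phi> \<le> e" by simp
    qed
  next
    case False
    \<comment> \<open>The guard secures the bound required by genericity; where \<open>\<pi>\<close>
      agrees with a value of \<open>P\<close>, nothing changes.\<close>
    define \<tau> where "\<tau> l = (if \<pi> (Inl l) < r then \<pi> (Inl l) else 0)" for l
    have "\<forall>l. \<tau> l < r" unfolding \<tau>_def using Pr[of "[]"] by auto
    then obtain m where m: "m \<notin> range u"
      "\<forall>xs. length xs = n \<longrightarrow> m \<in> set xs \<longrightarrow> set xs \<subseteq> insert m (range u) \<longrightarrow>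
          P xs = \<tau> (map (\<lambda>z. if z = m then None else Some z) xs)"
      using conjunct2[OF gen[unfolded generic_relation_def], rule_format, of \<tau> u] by blast
    show ?thesis
    proof (rule zero)
      fix \<phi> s and e :: real assume mem: "(\<phi>, s) \<in> p" and e: "0 < e"
      have \<phi>: "cwf ?\<sigma> \<phi>" and sA: "\<And>v. v \<in> cfv \<phi> \<Longrightarrow> v \<noteq> 0 \<Longrightarrow> s v \<in> A" using wf mem by blast+
      let ?V = "cfv \<phi>" and ?o = "\<lambda>v. if v = 0 then None else Some (s v)"
      \<comment> \<open>Finitely many data that determine the value of \<open>\<phi>\<close>:
        equalities with its parameters and \<open>P\<close> on tuples of its variables.\<close>
      let ?K = "Inr ` s ` ?V \<union> Inl ` map ?o ` {xs. set xs \<subseteq> ?V \<and> length xs = n}"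
      have finK: "finite ?K" using finite_cfv finite_lists_length_eq by blast
      obtain m0 where m0: "feval ?M (s(0 := m0)) \<phi> \<le> e" "\<forall>k\<in>?K. f m0 k = \<pi> k"
        using \<pi>[OF mem e finK] by (elim exE conjE)
      have new: "s v \<noteq> m0" "s v \<noteq> m" if "v \<in> ?V" "v \<noteq> 0" for v
      proof -
        have "f m0 (Inr (s v)) = \<pi> (Inr (s v))" using m0(2) that by blast
        then show "s v \<noteq> m0" using False sA[OF that] by (auto simp: f_def)
        show "s v \<noteq> m" using m(1) u sA[OF that] by blast
      qed
      have "same_qf n P ?V (s(0 := m0)) (s(0 := m))"
        unfolding same_qf_def
      proof (intro conjI allI impI ballI)
        show "(s(0 := m0)) v = (s(0 := m0)) w \<longleftrightarrow> (s(0 := m)) v = (s(0 := m)) w" if "v \<in> ?V" "w \<in> ?V" for v w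
          using new[OF that(1)] new[OF that(2)] by (metis fun_upd_apply)
        fix xs assume xs: "length xs = n" "set xs \<subseteq> ?V"
        show "P (map (s(0 := m0)) xs) = P (map (s(0 := m)) xs)"
        proof (cases "0 \<in> set xs")
          case True
          let ?ys = "map (s(0 := m)) xs"
          have "m \<in> set ?ys" using True by force
          moreover have "set ?ys \<subseteq> insert m (range u)" using xs(2) u sA by auto
          moreover have "length ?ys = n" using xs(1) by simp
          ultimately have "P ?ys = \<tau> (map (\<lambda>z. if z = m then None else Some z) ?ys)"
            using m(2) by blast
          also have "map (\<lambda>z. if z = m then None else Some z) ?ys = map ?o xs"
            using new(2) xs(2) by auto
          also have "\<tau> (map ?o xs) = P (map (s(0 := m0)) xs)"
          proof -
            have "Inl (map ?o xs) \<in> ?K" using xs by blast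
            from bspec[OF m0(2) this] have "\<pi> (Inl (map ?o xs)) = f m0 (Inl (map ?o xs))" by (rule sym)
            also have "\<dots> = P (map (case_option m0 (\<lambda>z. z)) (map ?o xs))" by (simp add: f_def)
            also have "map (case_option m0 (\<lambda>z. z)) (map ?o xs) = map (s(0 := m0)) xs" by simp
            finally show ?thesis using Pr unfolding \<tau>_def by simp
          qed
          finally show ?thesis ..
        next
          case False
          then have "map (s(0 := m0)) xs = map s xs" "map (s(0 := m)) xs = map s xs" by auto
          then show ?thesis by (simp only:)
        qed
      qed
      from feval_same_qf[OF inf gen \<phi> this] show "feval ?M (s(0 := m)) \<phi> \<le> e"
        using m0(1) by simp
    qed
  qed
qed

subsection \<open>Failure of the Ramsey property\<close>

lemma finite_binom:
  assumes "finite A" "finite B"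
  shows "finite (binom I B A)"
proof (rule finite_subset)
  show "binom I B A \<subseteq> A \<rightarrow>\<^sub>E B" by (auto simp: binom_def emb_def PiE_def)
  show "finite (A \<rightarrow>\<^sub>E B)" using assms by (intro finite_PiE) auto
qed

text \<open>Finitely many substructures lie in the one generated by their union, whose bad colouring
  is bad for all of them. The limit \<open>\<pi>\<close> stays bad because badness at
  \<open>f\<close> involves only finitely many colours.\<close>

lemma global_bad_colouring:
  fixes I :: "('i,'f,'r) fstruct"
  assumes lf: "locally_finite I" and A: "fin_sub I A" and B: "fin_sub I B" and AB: "A \<subseteq> B"
    and bad: "\<And>C. fin_sub I C \<Longrightarrow> \<not> arrows I C B A r"
  shows "\<exists>col. (\<forall>e. col e < r) \<and>
    (\<forall>f. emb I B UNIV f \<longrightarrow> \<not> (\<exists>c. \<forall>e\<in>binom I B A. col (compose A f e) = c))"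
proof -
  have clA: "closed_sub I A" and clB: "closed_sub I B" and finA: "finite A" and finB: "finite B"
    using A B by (auto simp: fin_sub_def)
  \<comment> \<open>A bad colouring of the copies inside \<open>B\<close> must give the inclusion of
    \<open>A\<close> some colour.\<close>
  have r0: "0 < r"
  proof (rule ccontr)
    assume "\<not> 0 < r"
    moreover obtain col where "col \<in> binom I B A \<rightarrow> {..<r}" using bad[OF B] unfolding arrows_def by blast
    moreover have "(\<lambda>x\<in>A. x) \<in> binom I B A" using emb_inclusion[OF clA AB] by (simp add: binom_def)
    ultimately show False by auto
  qed
  \<comment> \<open>Bad colourings are bounded only on embeddings into a given substructure, whereas
    compactness needs a bound everywhere.\<close>
  define clip where "clip col k = (if col k < r then col k else 0)" for col :: "('i \<Rightarrow> 'i) \<Rightarrow> nat" and k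
  have "\<exists>\<pi>. \<forall>Q K. finite Q \<longrightarrow> Q \<subseteq> {C. fin_sub I C} \<longrightarrow> finite K \<longrightarrow>
    (\<exists>col. (\<forall>C\<in>Q. \<forall>f\<in>binom I C B. \<not> (\<exists>c. \<forall>e\<in>binom I B A. clip col (compose A f e) = c)) \<and>
       (\<forall>k\<in>K. clip col k = \<pi> k))"
  proof (rule finite_colour_compactness)
    show "clip col k < r" for col k unfolding clip_def using r0 by simp
    fix Q assume Q: "finite Q" "Q \<subseteq> {C. fin_sub I C}"
    let ?C = "gen_sub I (\<Union>Q)"
    have "finite (\<Union>Q)" using Q by (auto simp: fin_sub_def)
    then have "fin_sub I ?C" by (rule fin_sub_gen_sub[OF lf])
    then obtain col where col: "col \<in> binom I ?C A \<rightarrow> {..<r}"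
      "\<forall>f\<in>binom I ?C B. \<not> (\<exists>c. \<forall>e\<in>binom I B A. col (compose A f e) = c)"
      using bad unfolding arrows_def by blast
    have "\<not> (\<exists>c. \<forall>e\<in>binom I B A. clip col (compose A f e) = c)" if "C \<in> Q" "f \<in> binom I C B" for C f
    proof -
      have f: "emb I B C f" using that(2) by (simp add: binom_def)
      have "C \<subseteq> ?C" using that(1) gen_sub_superset[of "\<Union>Q" I] by blast
      then have f': "emb I B ?C f" using embD(2)[OF f] by (intro emb_image_mono[OF f]) auto
      have "clip col (compose A f e) = col (compose A f e)" if "e \<in> binom I B A" for e
      proof -
        have "compose A f e \<in> binom I ?C A"
          using emb_compose[OF clA _ f'] that by (simp add: binom_def)
        then show ?thesis using col(1) unfolding clip_def by auto
      qed
      moreover have "f \<in> binom I ?C B" using f' by (simp add: binom_def)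
      ultimately show ?thesis using col(2) by simp
    qed
    then show "\<exists>col. \<forall>C\<in>Q. \<forall>f\<in>binom I C B. \<not> (\<exists>c. \<forall>e\<in>binom I B A. clip col (compose A f e) = c)" by blast
  qed
  then obtain \<pi> where \<pi>: "\<forall>Q K. finite Q \<longrightarrow> Q \<subseteq> {C. fin_sub I C} \<longrightarrow> finite K \<longrightarrow>
    (\<exists>col. (\<forall>C\<in>Q. \<forall>f\<in>binom I C B. \<not> (\<exists>c. \<forall>e\<in>binom I B A. clip col (compose A f e) = c)) \<and>
       (\<forall>k\<in>K. clip col k = \<pi> k))" by (rule exE)
  have "\<pi> k < r" for k
  proof -
    obtain col where "clip col k = \<pi> k" using \<pi>[THEN spec[of _ "{}"], THEN spec[of _ "{k}"]] by auto
    then show ?thesis unfolding clip_def using r0 by (auto split: if_splits)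
  qed
  moreover have "\<not> (\<exists>c. \<forall>e\<in>binom I B A. \<pi> (compose A f e) = c)" if f: "emb I B UNIV f" for f
  proof -
    have C: "fin_sub I (f ` B)" using emb_image_closed[OF f clB] finB by (simp add: fin_sub_def)
    have fin: "finite ((\<lambda>e. compose A f e) ` binom I B A)" using finite_binom[OF finA finB] by (rule finite_imageI)
    obtain col where col: "\<forall>f'\<in>binom I (f ` B) B. \<not> (\<exists>c. \<forall>e\<in>binom I B A. clip col (compose A f' e) = c)"
      "\<forall>e\<in>binom I B A. clip col (compose A f e) = \<pi> (compose A f e)"
      using \<pi>[THEN spec[of _ "{f ` B}"], THEN spec[of _ "(\<lambda>e. compose A f e) ` binom I B A"]] C fin by auto
    have "f \<in> binom I (f ` B) B" using emb_image_mono[OF f] by (simp add: binom_def)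
    then have "\<not> (\<exists>c. \<forall>e\<in>binom I B A. clip col (compose A f e) = c)" using col(1) by blast
    then show ?thesis using col(2) by simp
  qed
  ultimately show ?thesis by blast
qed

text \<open>Local basedness, applied to all copies of \<open>A\<close> in \<open>B\<close> at once,
  finds a copy of \<open>B\<close> in the index structure on which the colours equal the values
  along \<open>b\<close>, and indiscernibility makes those constant.\<close>

lemma CMP_imp_age_ERP:
  fixes I :: "('i,'f,'r) fstruct" and h :: "'i \<Rightarrow> 'y"
  assumes inf: "infinite (UNIV :: 'y set)" and h: "inj h" and lf: "locally_finite I"
    and cmp: "CMP I TYPE('g) TYPE('s) TYPE('y set)"
  shows "age_ERP I"
proof (rule ccontr)
  assume "\<not> age_ERP I"
  then obtain A B r where A: "fin_sub I A" and B: "fin_sub I B" and AB: "A \<subseteq> B"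
    and bad: "\<And>C. fin_sub I C \<Longrightarrow> \<not> arrows I C B A r"
    unfolding age_ERP_def by blast
  have clA: "closed_sub I A" and clB: "closed_sub I B" and finA: "finite A" and finB: "finite B"
    using A B by (auto simp: fin_sub_def)
  obtain col where col: "\<And>e. col e < r"
    "\<And>f. emb I B UNIV f \<Longrightarrow> \<not> (\<exists>c. \<forall>e\<in>binom I B A. col (compose A f e) = c)"
    using global_bad_colouring[OF lf A B AB bad] by blast
  have r0: "0 < r" using col(1)[of undefined] by simp
  obtain as where as: "set as = A" using finite_list[OF finA] by blast
  obtain js where js: "set js = B" using finite_list[OF finB] by blast
  define n where "n = length as"
  define a where "a i = {h i}" for i
  have inj_a: "inj a" using h by (auto simp: a_def inj_def)
  \<comment> \<open>The tuple determines the embedding: \<open>a\<close> is injective,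
    \<open>as\<close> lists \<open>A\<close>, and embeddings are extensional.\<close>
  define c where "c xs = col (SOME e. emb I A UNIV e \<and> xs = map a (map e as))" for xs
  have c: "c (map a (map e as)) = col e" if e: "emb I A UNIV e" for e
  proof -
    have "e' = e" if "emb I A UNIV e' \<and> map a (map e as) = map a (map e' as)" for e'
    proof (rule extensionalityI[of _ A])
      show "e' \<in> extensional A" "e \<in> extensional A" using that e embD(1) by blast+
      have "map e as = map e' as" using that inj_a by (simp only: inj_map_eq_map)
      then show "e' x = e x" if "x \<in> A" for x using that as by auto
    qed
    then have "(SOME e'. emb I A UNIV e' \<and> map a (map e as) = map a (map e' as)) = e"
      using e by (intro some_equality) auto
    then show ?thesis unfolding c_def by simp
  qed
  \<comment> \<open>Prescribed families are indexed by \<open>'y\<close>, so \<open>a\<close> is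
    reindexed through \<open>inv h\<close>.\<close>
  define d where "d = a \<circ> inv h"
  have rd: "range a \<subseteq> range d" unfolding d_def using inj_imp_surj_inv[OF h] by (metis image_comp order_refl)
  have cr: "c xs < r" for xs unfolding c_def by (rule col(1))
  from generic_relation_exists[of c r n d, OF inf cr]
  obtain P where gen: "generic_relation n r P" and Pc: "\<forall>xs. set xs \<subseteq> range d \<longrightarrow> P xs = c xs"
    by (elim exE conjE)
  have Pcol: "P (map a (map e as)) = col e" if "emb I A UNIV e" for e
  proof -
    have "set (map a (map e as)) \<subseteq> range d" using rd by auto
    then show ?thesis using Pc c[OF that] by simp
  qed
  let ?M = "discrete_struct r P :: ('y set,'g,'s) mstruct" and ?\<sigma> = "discrete_sig n :: ('g,'s) csig"
  have "mstruct_ok ?\<sigma> ?M" using gen unfolding generic_relation_def by (intro mstruct_ok_discrete) blast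
  moreover have "csaturated ?\<sigma> ?M (UNIV :: 'i set)" by (rule csaturated_generic[OF inf gen h])
  ultimately have "cmp_in I ?\<sigma> ?M" using cmp unfolding CMP_def by blast
  then obtain b where ind: "indiscernible I ?\<sigma> ?M b" and based: "locally_based I ?\<sigma> ?M b a"
    unfolding cmp_in_def by blast
  define R where "R = (undefined :: 's)"
  define rel where "rel vs = (CRel R (map Var vs) :: ('g,'s) cfml)" for vs
  have rel_eval: "feval ?M s (rel vs) = real (P (map s vs)) / real r" for s vs
    unfolding rel_def by (simp add: o_def)
  have rel_wf: "cwf ?\<sigma> (rel vs) \<longleftrightarrow> length vs = n" "cfv (rel vs) = set vs" for vs
    unfolding rel_def by (auto simp: list_all_iff)
  have const: "P (map b (map e as)) = P (map b as)" if e: "emb I A B e" for e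
  proof -
    have "qftp_eq I (map e as) as" using qftp_eq_emb[OF e clA] as by simp
    moreover have "cwf ?\<sigma> (rel [0..<n]) \<and> cfv (rel [0..<n]) \<subseteq> {..<length (map e as)}"
      by (auto simp: rel_wf) (auto simp: n_def)
    ultimately have "feval ?M ((!) (map b (map e as))) (rel [0..<n]) = feval ?M ((!) (map b as)) (rel [0..<n])"
      by (rule ind[unfolded indiscernible_def, THEN spec, THEN spec, THEN mp, THEN spec, THEN mp])
    moreover have "map ((!) (map b (map e as))) [0..<n] = map b (map e as)" "map ((!) (map b as)) [0..<n] = map b as"
      unfolding n_def by (metis length_map map_nth)+
    ultimately show ?thesis using r0 unfolding rel_eval by simp
  qed
  have "\<forall>x\<in>B. \<exists>k. k < length js \<and> js ! k = x" using js by (auto simp: in_set_conv_nth)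
  from bchoice[OF this] obtain pos where pos: "\<forall>x\<in>B. pos x < length js \<and> js ! pos x = x" by (rule exE)
  \<comment> \<open>One formula per copy of \<open>A\<close> in \<open>B\<close>, its variables
    being positions in the enumeration \<open>js\<close>.\<close>
  define \<Delta> where "\<Delta> = (\<lambda>e. rel (map pos (map e as))) ` binom I B A"
  have "finite \<Delta>" unfolding \<Delta>_def using finite_binom[OF finA finB] by (rule finite_imageI)
  moreover have "\<forall>\<phi>\<in>\<Delta>. cwf ?\<sigma> \<phi> \<and> cfv \<phi> \<subseteq> {..<length js}"
  proof -
    have "pos (e x) < length js" if "emb I A B e" "x \<in> set as" for e x
      using embD(2)[OF that(1)] that(2) as pos by blast
    then show ?thesis unfolding \<Delta>_def rel_wf binom_def by (auto simp: rel_wf n_def[symmetric])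
  qed
  \<comment> \<open>Half the gap between distinct relation values, so agreement within this
    tolerance is equality.\<close>
  moreover have "1 / (2 * real r) > 0" using r0 by simp
  ultimately obtain ks where ks: "qftp_eq I ks js"
    "\<forall>\<phi>\<in>\<Delta>. \<bar>feval ?M ((!) (map b js)) \<phi> - feval ?M ((!) (map a ks)) \<phi>\<bar> \<le> 1 / (2 * real r)"
    using based[unfolded locally_based_def, THEN spec[of _ \<Delta>], THEN spec[of _ js], THEN spec[of _ "1 / (2 * real r)"]]
    by blast
  obtain f where f0: "emb I (gen_sub I (set js)) (gen_sub I (set ks)) f" and fjs: "map f js = ks"
    using emb_of_qftp_eq[OF qftp_eq_sym[OF ks(1)]] by blast
  have "gen_sub I (set js) = B"
    using js gen_sub_least[of B B I] gen_sub_superset[of B I] clB by auto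
  then have f: "emb I B UNIV f" using f0 emb_image_mono[OF f0, of UNIV] by simp
  have "col (compose A f e) = P (map b as)" if "e \<in> binom I B A" for e
  proof -
    have e: "emb I A B e" using that by (simp add: binom_def)
    have posn: "pos (e x) < length js" "js ! pos (e x) = e x" if "x \<in> set as" for x
      using embD(2)[OF e] that as pos by blast+
    have "map ((!) (map b js)) (map pos (map e as)) = map b (map e as)"
      using posn by simp
    moreover have "map ((!) (map a ks)) (map pos (map e as)) = map a (map (compose A f e) as)"
      using posn as by (auto simp: fjs[symmetric] compose_def)
    moreover have "emb I A UNIV (compose A f e)" using emb_compose[OF clA e f] .
    moreover have "\<bar>feval ?M ((!) (map b js)) (rel (map pos (map e as))) -
        feval ?M ((!) (map a ks)) (rel (map pos (map e as)))\<bar> \<le> 1 / (2 * real r)"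
      using ks(2) that unfolding \<Delta>_def by blast
    ultimately have "\<bar>real (P (map b as)) / real r - real (col (compose A f e)) / real r\<bar> \<le> 1 / (2 * real r)"
      unfolding rel_eval using Pcol[of "compose A f e"] const[OF e] by (simp only:)
    then have "\<bar>real (P (map b as)) - real (col (compose A f e))\<bar> / real r \<le> (1 / 2) / real r"
      using r0 by (simp add: diff_divide_distrib[symmetric] abs_divide)
    then have "\<bar>real (P (map b as)) - real (col (compose A f e))\<bar> \<le> 1 / 2"
      using r0 by (simp only: divide_le_cancel)
    then show ?thesis by linarith
  qed
  then show False using col(2)[OF f] by blast
qed

text \<open>A HOL formula cannot quantify over types. The passage to arbitrary theories is therefore
  a conjunct with arbitrary types, and the equivalence is stated at fixed types with room for the
  generic structure.\<close>

theorem theorem3p10: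
  fixes I :: "('i,'f,'r) fstruct"
  assumes "infinite (UNIV :: 'i set)"
    and "locally_finite I"
  shows "(age_ERP I \<longrightarrow> CMP I TYPE('g) TYPE('s) TYPE('m))
       \<and> (age_ERP I \<longleftrightarrow>
            CMP I TYPE(('i,'f,'r) bigsym) TYPE(('i,'f,'r) bigsym) TYPE(('i,'f,'r) bigsym set set))"
proof (intro conjI impI iffI)
  show "CMP I TYPE('g) TYPE('s) TYPE('m)" if "age_ERP I"
    using assms(2) that by (rule age_ERP_imp_CMP)
  show "CMP I TYPE(('i,'f,'r) bigsym) TYPE(('i,'f,'r) bigsym) TYPE(('i,'f,'r) bigsym set set)" if "age_ERP I"
    using assms(2) that by (rule age_ERP_imp_CMP)
  assume cmp: "CMP I TYPE(('i,'f,'r) bigsym) TYPE(('i,'f,'r) bigsym) TYPE(('i,'f,'r) bigsym set set)"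
  \<comment> \<open>Here \<open>'y\<close> is the type of sets of symbols, so that
    \<open>'y set\<close> is the type of models in the statement.\<close>
  have h: "inj (\<lambda>i. {Inl i} :: ('i,'f,'r) bigsym set)" by (auto simp: inj_def)
  have "infinite (UNIV :: ('i,'f,'r) bigsym set set)"
    using finite_imageD[OF _ h] assms(1) finite_subset[OF subset_UNIV] by blast
  then show "age_ERP I" using h assms(2) cmp by (rule CMP_imp_age_ERP)
qed

end
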